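(* Let $\mu$ be the Gaussian measure on $\mathbb{R}^n$ or the exponential measure on $\mathbb{R}^n_+$ (see context), with moments $y_\alpha=\int\mathbf{x}^\alpha\,d\mu$. Let $\Omega=\{\mathbf{x}\in\mathbb{R}^n:g_j(\mathbf{x})\ge0,\ j=1,\dots,m\}$ with $g_j\in\mathbb{R}[\mathbf{x}]$; when $\mu$ is the exponential measure the constraints $x_i\ge0$, $i=1,\dots,n$, are among the constraints $g_j\ge0$. Let $\Omega^c=\operatorname{supp}\mu\setminus\Omega$ and assume that both $\Omega$ and $\Omega^c$ have nonempty interior. Let $\Omega^c_\ell=\{\mathbf{x}:g_{\ell j}(\mathbf{x})\ge0,\ j=1,\dots,m_\ell\}\subseteq\operatorname{supp}\mu$, $\ell=1,\dots,s$, $g_{\ell j}\in\mathbb{R}[\mathbf{x}]$, be such that $\Omega^c=\bigcup_{\ell=1}^s\Omega^c_\ell$ up to a set of $\mu$-measure zero, with pairwise overlaps of $\mu$-measure zero. Assume $\Omega$ and each $\Omega^c_\ell$ is the closure of its interior. For each $\ell$ let $f_\ell\in\mathbb{R}[\mathbf{x}]$ be a fixed nonzero polynomial vanishing on $\partial\Omega^c_\ell$, and for $\alpha\in\mathbb{N}^n$, $i=1,\dots,n$, let $$p^\ell_{i,\alpha}=\frac{\partial(\mathbf{x}^\alpha f_\ell)}{\partial x_i}-\mathbf{x}^\alpha f_\ell\,x_i\ \text{ (Gaussian case)},\qquad p^\ell_{i,\alpha}=\frac{\partial(\mathbf{x}^\alpha f_\ell)}{\partial x_i}-\mathbf{x}^\alpha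 f_\ell\ \text{ (exponential case)},$$ with $r_\ell(d)=2d-1-\deg f_\ell$ in the Gaussian case and $r_\ell(d)=2d-\deg f_\ell$ in the exponential case. Let $d_{\ell j}=\lceil\deg(g_{\ell j})/2\rceil$ and $d_0=\max_{\ell,j}d_{\ell j}$. For $d\ge d_0$ let $$\overline{\omega}^c_{\ell d}=\sup_{\mathbf{u},\mathbf{v}}\Big\{u_0:\ u_\alpha+v_\alpha=y_\alpha\ \forall\alpha\in\mathbb{N}^n_{2d};\ \mathbf{M}_d(\mathbf{u})\succeq0,\ \mathbf{M}_d(\mathbf{v})\succeq0;\ \mathbf{M}_{d-d_{\ell j}}(g_{\ell j}\,\mathbf{u})\succeq0,\ j=1,\dots,m_\ell;\ L_{\mathbf{u}}(p^\ell_{i,\alpha})=0\ \forall\alpha\in\mathbb{N}^n_{r_\ell(d)},\ i=1,\dots,n\Big\}$$ over $\mathbf{u}=(u_\alpha)_{\alpha\in\mathbb{N}^n_{2d}}$, $\mathbf{v}=(v_\alpha)_{\alpha\in\mathbb{N}^n_{2d}}$, and let $$\underline{\omega}_d:=\mu(\mathbb{R}^n)-\sum_{\ell=1}^s\overline{\omega}^c_{\ell d}.$$ Then the sequence $(\underline{\omega}_d)$ is monotone non-decreasing, $\mu(\Omega)\ge\underline{\omega}_d$ for all $d\ge d_0$, and $\underline{\omega}_d\to\mu(\Omega)$ as $d\to\infty$.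
   Context: Measures: the Gaussian measure is $\mu(B)=(2\pi)^{-n/2}\int_B\exp(-\|\mathbf{x}\|^2/2)\,d\mathbf{x}$ for Borel $B\subseteq\mathbb{R}^n$ (support $\mathbb{R}^n$); the exponential measure is $\mu(B)=(2\pi)^{-n/2}\int_B\exp(-\sum_{i=1}^n x_i)\,d\mathbf{x}$ for Borel $B\subseteq\mathbb{R}^n_+$, viewed as a measure on $\mathbb{R}^n$ with support $\mathbb{R}^n_+=\{\mathbf{x}:\mathbf{x}\ge0\}$. Notation: $\mathbb{N}^n_k=\{\alpha\in\mathbb{N}^n:\sum_i\alpha_i\le k\}$ (empty if $k<0$). For a (truncated) sequence $\mathbf{z}=(z_\alpha)$, $L_{\mathbf{z}}(\sum_\alpha f_\alpha\mathbf{x}^\alpha)=\sum_\alpha f_\alpha z_\alpha$. The moment matrix $\mathbf{M}_k(\mathbf{z})$ has rows and columns indexed by $\mathbb{N}^n_k$ and $(\alpha,\beta)$ entry $z_{\alpha+\beta}$; for $g=\sum_\gamma g_\gamma\mathbf{x}^\gamma$ the localizing matrix $\mathbf{M}_k(g\,\mathbf{z})$ has rows and columns indexed by $\mathbb{N}^n_k$ and $(\alpha,\beta)$ entry $\sum_\gamma g_\gamma z_{\alpha+\beta+\gamma}$. $\mathbf{A}\succeq0$ means the real symmetric matrix $\mathbf{A}$ is positive semidefinite. *)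

theory Defs
  imports "HOL-Probability.Probability" "HOL-Library.Poly_Mapping"
begin

text \<open>
  Exponents are vectors of type \<^typ>\<open>nat ^ 'n\<close>, where \<open>'n\<close> is a finite type with \<open>n\<close> elements.
  A real polynomial in \<open>n\<close> variables is a finitely supported map from exponents to coefficients;
  the ring structure (convolution product) is that of \<^theory>\<open>HOL-Library.Poly_Mapping\<close>.
\<close>

type_synonym 'n rpoly = "(nat ^ 'n) \<Rightarrow>\<^sub>0 real"

definition exp_deg :: "nat ^ 'n::finite \<Rightarrow> nat" where
  "exp_deg \<alpha> = (\<Sum>i\<in>UNIV. \<alpha> $ i)"

definition monom_eval :: "nat ^ 'n::finite \<Rightarrow> real ^ 'n \<Rightarrow> real" where
  "monom_eval \<alpha> x = (\<Prod>i\<in>UNIV. (x $ i) ^ (\<alpha> $ i))"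

definition rpoly_eval :: "'n::finite rpoly \<Rightarrow> real ^ 'n \<Rightarrow> real" where
  "rpoly_eval p x = (\<Sum>\<alpha>\<in>Poly_Mapping.keys p. Poly_Mapping.lookup p \<alpha> * monom_eval \<alpha> x)"

text \<open>The degree of the zero polynomial is 0 by convention.\<close>

definition total_deg :: "'n::finite rpoly \<Rightarrow> nat" where
  "total_deg p = (if p = 0 then 0 else Max (exp_deg ` Poly_Mapping.keys p))"

definition rmonom :: "nat ^ 'n::finite \<Rightarrow> 'n rpoly" where
  "rmonom \<alpha> = Poly_Mapping.single \<alpha> 1"

definition rvar :: "'n::finite \<Rightarrow> 'n rpoly" where
  "rvar i = rmonom (axis i 1)"

text \<open>
  The subtraction \<open>\<alpha> - axis i 1\<close> truncates when \<open>\<alpha> $ i = 0\<close>, but then the coefficient is 0.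
\<close>

definition partial_deriv :: "'n::finite \<Rightarrow> 'n rpoly \<Rightarrow> 'n rpoly" where
  "partial_deriv i p =
    (\<Sum>\<alpha>\<in>Poly_Mapping.keys p.
      Poly_Mapping.single (\<alpha> - axis i 1) (real (\<alpha> $ i) * Poly_Mapping.lookup p \<alpha>))"

definition semialg :: "nat \<Rightarrow> (nat \<Rightarrow> 'n::finite rpoly) \<Rightarrow> (real ^ 'n) set" where
  "semialg m g = {x. \<forall>j\<in>{1..m}. 0 \<le> rpoly_eval (g j) x}"

datatype measure_kind = Gaussian | Exponential

definition nonneg_orthant :: "(real ^ 'n::finite) set" where
  "nonneg_orthant = {x. \<forall>i. 0 \<le> x $ i}"

text \<open>The factor \<open>(2\<pi>) powr (-n/2)\<close> in the exponential case is intended.\<close>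

fun ref_measure :: "measure_kind \<Rightarrow> (real ^ 'n::finite) measure" where
  "ref_measure Gaussian =
    density lborel (\<lambda>x. ennreal ((2 * pi) powr (- real CARD('n) / 2) * exp (- (norm x)\<^sup>2 / 2)))"
| "ref_measure Exponential =
    density lborel (\<lambda>x. ennreal ((2 * pi) powr (- real CARD('n) / 2) * exp (- (\<Sum>i\<in>UNIV. x $ i))
      * indicator nonneg_orthant x))"

definition measure_support :: "'a::topological_space measure \<Rightarrow> 'a set" where
  "measure_support M = {x. \<forall>U. open U \<and> x \<in> U \<longrightarrow> 0 < emeasure M U}"

definition moments :: "measure_kind \<Rightarrow> nat ^ 'n::finite \<Rightarrow> real" where
  "moments \<kappa> \<alpha> = (\<integral>x. monom_eval \<alpha> x \<partial>ref_measure \<kappa>)"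

text \<open>The bound is an integer so that the index set is empty for a negative bound.\<close>

definition exps_upto :: "int \<Rightarrow> (nat ^ 'n::finite) set" where
  "exps_upto k = {\<alpha>. int (exp_deg \<alpha>) \<le> k}"

definition riesz :: "(nat ^ 'n \<Rightarrow> real) \<Rightarrow> 'n::finite rpoly \<Rightarrow> real" where
  "riesz z p = (\<Sum>\<alpha>\<in>Poly_Mapping.keys p. Poly_Mapping.lookup p \<alpha> * z \<alpha>)"

text \<open>
  The matrices below are given by their entries; the index set \<^term>\<open>exps_upto k\<close> of rows and columns
  is supplied to \<open>psd_on\<close>.
\<close>

definition moment_matrix :: "(nat ^ 'n::finite \<Rightarrow> real) \<Rightarrow> nat ^ 'n \<Rightarrow> nat ^ 'n \<Rightarrow> real" where
  "moment_matrix z \<alpha> \<beta> = z (\<alpha> + \<beta>)"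

definition localizing_matrix ::
  "'n::finite rpoly \<Rightarrow> (nat ^ 'n \<Rightarrow> real) \<Rightarrow> nat ^ 'n \<Rightarrow> nat ^ 'n \<Rightarrow> real" where
  "localizing_matrix g z \<alpha> \<beta> =
    (\<Sum>\<gamma>\<in>Poly_Mapping.keys g. Poly_Mapping.lookup g \<gamma> * z (\<alpha> + \<beta> + \<gamma>))"

definition psd_on :: "'i set \<Rightarrow> ('i \<Rightarrow> 'i \<Rightarrow> real) \<Rightarrow> bool" where
  "psd_on I A \<longleftrightarrow>
    (\<forall>a\<in>I. \<forall>b\<in>I. A a b = A b a) \<and>
    (\<forall>c :: 'i \<Rightarrow> real. 0 \<le> (\<Sum>a\<in>I. \<Sum>b\<in>I. c a * A a b * c b))"

fun stokes_poly ::
  "measure_kind \<Rightarrow> 'n::finite rpoly \<Rightarrow> 'n \<Rightarrow> nat ^ 'n \<Rightarrow> 'n rpoly" where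
  "stokes_poly Gaussian f i \<alpha> = partial_deriv i (rmonom \<alpha> * f) - rmonom \<alpha> * f * rvar i"
| "stokes_poly Exponential f i \<alpha> = partial_deriv i (rmonom \<alpha> * f) - rmonom \<alpha> * f"

fun stokes_deg :: "measure_kind \<Rightarrow> 'n::finite rpoly \<Rightarrow> nat \<Rightarrow> int" where
  "stokes_deg Gaussian f d = 2 * int d - 1 - int (total_deg f)"
| "stokes_deg Exponential f d = 2 * int d - int (total_deg f)"

definition half_deg :: "'n::finite rpoly \<Rightarrow> nat" where
  "half_deg p = nat \<lceil>real (total_deg p) / 2\<rceil>"

definition min_order :: "nat \<Rightarrow> (nat \<Rightarrow> nat) \<Rightarrow> (nat \<Rightarrow> nat \<Rightarrow> 'n::finite rpoly) \<Rightarrow> nat" where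
  "min_order s mc gc = Max {half_deg (gc l j) | l j. l \<in> {1..s} \<and> j \<in> {1..mc l}}"

text \<open>
  The truncated sequences \<open>u\<close> and \<open>v\<close> are represented by functions on all exponents. For \<open>d\<close> at
  least the half degree of each \<open>g j\<close>, the constraints only involve entries of degree at most
  \<open>2 * d\<close>, so the remaining entries are irrelevant.
\<close>

definition stokes_feasible ::
  "measure_kind \<Rightarrow> nat \<Rightarrow> (nat \<Rightarrow> 'n::finite rpoly) \<Rightarrow> 'n rpoly \<Rightarrow> nat \<Rightarrow>
    (nat ^ 'n \<Rightarrow> real) \<Rightarrow> (nat ^ 'n \<Rightarrow> real) \<Rightarrow> bool" where
  "stokes_feasible \<kappa> m g f d u v \<longleftrightarrow>
    (\<forall>\<alpha>\<in>exps_upto (2 * int d). u \<alpha> + v \<alpha> = moments \<kappa> \<alpha>) \<and>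
    psd_on (exps_upto (int d)) (moment_matrix u) \<and>
    psd_on (exps_upto (int d)) (moment_matrix v) \<and>
    (\<forall>j\<in>{1..m}. psd_on (exps_upto (int d - int (half_deg (g j)))) (localizing_matrix (g j) u)) \<and>
    (\<forall>i. \<forall>\<alpha>\<in>exps_upto (stokes_deg \<kappa> f d). riesz u (stokes_poly \<kappa> f i \<alpha>) = 0)"

definition omega_upper ::
  "measure_kind \<Rightarrow> nat \<Rightarrow> (nat \<Rightarrow> 'n::finite rpoly) \<Rightarrow> 'n rpoly \<Rightarrow> nat \<Rightarrow> real" where
  "omega_upper \<kappa> m g f d = Sup {u 0 | u v. stokes_feasible \<kappa> m g f d u v}"

definition omega_lower ::
  "measure_kind \<Rightarrow> nat \<Rightarrow> (nat \<Rightarrow> nat) \<Rightarrow> (nat \<Rightarrow> nat \<Rightarrow> 'n::finite rpoly) \<Rightarrow>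
    (nat \<Rightarrow> 'n rpoly) \<Rightarrow> nat \<Rightarrow> real" where
  "omega_lower \<kappa> s mc gc f d =
    measure (ref_measure \<kappa> :: (real ^ 'n) measure) UNIV
      - (\<Sum>l=1..s. omega_upper \<kappa> (mc l) (gc l) (f l) d)"

lemma closed_nonneg_orthant: "closed (nonneg_orthant :: (real ^ 'n::finite) set)"
  unfolding nonneg_orthant_def by (intro closed_Collect_all closed_Collect_le continuous_intros)

lemma open_lborel_pos:
  fixes U :: "'a::euclidean_space set"
  assumes "open U" "U \<noteq> {}"
  shows "U \<notin> null_sets lborel"
  using assms by (meson open_not_negligible negligible_iff_null_sets null_sets_completionI)

lemma measure_support_Gaussian:
  "measure_support (ref_measure Gaussian :: (real ^ 'n::finite) measure) = UNIV"
proof -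
  have "0 < emeasure (ref_measure Gaussian :: (real ^ 'n) measure) U"
    if "open U" "x \<in> U" for U and x :: "real ^ 'n"
  proof (rule ccontr)
    assume "\<not> ?thesis"
    then have "U \<in> null_sets (ref_measure Gaussian)"
      using that by (auto simp: null_sets_def)
    then have "AE y in lborel. y \<notin> U"
      by (subst (asm) ref_measure.simps, subst (asm) null_sets_density_iff) (auto elim!: eventually_mono)
    then have "U \<in> null_sets lborel"
      using that by (subst (asm) AE_iff_null_sets[symmetric]) auto
    then show False
      using open_lborel_pos that by blast
  qed
  then show ?thesis
    by (auto simp: measure_support_def)
qed

lemma measure_support_Exponential:
  "measure_support (ref_measure Exponential :: (real ^ 'n::finite) measure) = nonneg_orthant"
proof (intro set_eqI iffI)
  fix x :: "real ^ 'n"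
  assume x: "x \<in> measure_support (ref_measure Exponential)"
  show "x \<in> nonneg_orthant"
  proof (rule ccontr)
    assume nx: "x \<notin> nonneg_orthant"
    have [measurable]: "(nonneg_orthant :: (real ^ 'n) set) \<in> sets borel"
      by (rule borel_closed[OF closed_nonneg_orthant])
    have "- nonneg_orthant \<in> null_sets (ref_measure Exponential :: (real ^ 'n) measure)"
      by (subst ref_measure.simps, subst null_sets_density_iff) auto
    then show False
      using x nx closed_nonneg_orthant unfolding measure_support_def null_sets_def
      by (auto dest!: spec[of _ "- nonneg_orthant"])
  qed
next
  fix x :: "real ^ 'n"
  assume x: "x \<in> nonneg_orthant"
  have [measurable]: "(nonneg_orthant :: (real ^ 'n) set) \<in> sets borel"
    by (rule borel_closed[OF closed_nonneg_orthant])
  have "0 < emeasure (ref_measure Exponential :: (real ^ 'n) measure) U"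
    if U: "open U" "x \<in> U" for U
  proof (rule ccontr)
    assume "\<not> ?thesis"
    then have "U \<in> null_sets (ref_measure Exponential)"
      using that by (auto simp: null_sets_def)
    then have ae: "AE y in lborel. \<not> (y \<in> U \<and> y \<in> nonneg_orthant)"
      by (subst (asm) ref_measure.simps, subst (asm) null_sets_density_iff) (auto elim!: eventually_mono)
    define V :: "(real ^ 'n) set" where "V = U \<inter> {y. \<forall>i. 0 < y $ i}"
    have "open {y :: real ^ 'n. \<forall>i. 0 < y $ i}"
      unfolding Collect_all_eq by (intro open_INT ballI open_Collect_less continuous_intros) auto
    then have "open V"
      using U by (auto simp: V_def)
    have "AE y in lborel. y \<notin> V"
      using ae by (rule eventually_mono) (auto simp: V_def nonneg_orthant_def intro: less_imp_le)
    then have "V \<in> null_sets lborel"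
      using \<open>open V\<close> by (subst (asm) AE_iff_null_sets[symmetric]) auto
    then have "V = {}"
      using open_lborel_pos \<open>open V\<close> by blast
    have "((\<lambda>t. x + t *\<^sub>R (\<chi> i. 1)) \<longlongrightarrow> x + 0 *\<^sub>R (\<chi> i. 1)) (at_right 0)"
      by (intro tendsto_intros)
    then have "\<forall>\<^sub>F t in at_right 0. x + t *\<^sub>R (\<chi> i. 1) \<in> U"
      using U by (intro topological_tendstoD) auto
    moreover have "\<forall>\<^sub>F t::real in at_right 0. t > 0"
      by (simp add: eventually_at_right_less)
    ultimately have "\<forall>\<^sub>F t::real in at_right 0. x + t *\<^sub>R (\<chi> i. 1) \<in> V"
      by eventually_elim (use x in \<open>auto simp: V_def nonneg_orthant_def add_nonneg_pos\<close>)
    then show False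
      using \<open>V = {}\<close> by simp
  qed
  then show "x \<in> measure_support (ref_measure Exponential)"
    by (auto simp: measure_support_def)
qed

end

theory Submission
  imports Defs
begin

text \<open>
  The truncated moments of \<open>\<mu>\<close> restricted to a piece \<open>K\<close> are feasible, so every relaxation bounds
  \<open>\<mu> K\<close> from above; the Stokes constraints hold because \<open>f\<close> vanishes on the boundary of \<open>K\<close>, which
  moreover is a null set as it lies in the zero set of \<open>f\<close>. Conversely, the functional of a feasible
  \<open>u\<close> is dominated by \<open>\<mu>\<close> on squares, hence bounded in \<open>L\<^sup>2(\<mu>)\<close> on polynomials of bounded degree.
  An identity \<open>1 = F\<^sub>0\<^sup>2 - \<Sum> g\<^sub>j F\<^sub>j\<^sup>2\<close> with bounded continuous \<open>F\<^sub>j\<close> and \<open>\<integral> F\<^sub>0\<^sup>2 d\<mu>\<close> close to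
  \<open>\<mu> K\<close> can be approximated by polynomials, because polynomials are dense in \<open>L\<^sup>4\<close> of a measure
  with exponential moments. This shows that \<open>u\<^sub>0\<close> is eventually at most \<open>\<mu> K + \<epsilon>\<close>, without
  solving a moment problem.
\<close>

section \<open>Polynomials and the Riesz functional\<close>

text \<open>The support is unbounded, so no Archimedean certificate can control a feasible
  \<open>u\<close>. What controls it is the positive semidefinite slack \<open>v\<close>: it keeps
  \<open>riesz u (p * p)\<close> below the \<mu>-integral of the square of p. Every estimate of
  \<open>u\<close> therefore has to pass through an L^2 norm for \<mu>. Replacing each F_j by a
  polynomial q_j in the identity leaves an error that is a sum of terms g_j (q_j^2 - F_j^2), and two
  choices follow. The factor g_j^2 in the squared error is moved into the measure, so approximation
  takes place for \<mu> with a polynomial density, which still has exponential moments. And since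
  the squares have to be close in L^2, the functions are approximated in L^4.

  For the Stokes constraints no smoothness of the boundary is assumed, so the divergence theorem is
  replaced by an argument along coordinate lines. It needs the boundary to be a null set, hence the
  study of zero sets of polynomials.\<close>

lemma riesz_eq_sum_superset:
  assumes "finite S" "Poly_Mapping.keys p \<subseteq> S"
  shows "riesz z p = (\<Sum>\<alpha>\<in>S. Poly_Mapping.lookup p \<alpha> * z \<alpha>)"
  unfolding riesz_def using assms by (intro sum.mono_neutral_left) (auto simp: in_keys_iff)

lemma riesz_zero [simp]: "riesz z 0 = 0"
  by (simp add: riesz_def)

lemma riesz_single [simp]: "riesz z (Poly_Mapping.single \<alpha> c) = c * z \<alpha>"
  by (simp add: riesz_def)

lemma riesz_one: "riesz z 1 = z 0"
  by (simp flip: single_one)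

lemma riesz_add: "riesz z (p + q) = riesz z p + riesz z q"
proof -
  let ?S = "Poly_Mapping.keys p \<union> Poly_Mapping.keys q"
  have "Poly_Mapping.keys (p + q) \<subseteq> ?S" by (rule keys_add)
  then show ?thesis
    by (simp add: riesz_eq_sum_superset[of ?S] lookup_add distrib_right sum.distrib)
qed

lemma riesz_diff: "riesz z (p - q) = riesz z p - riesz z q"
  using riesz_add[of z "p - q" q] by simp

lemma riesz_uminus: "riesz z (- p) = - riesz z p"
  using riesz_diff[of z 0 p] by simp

lemma riesz_sum: "riesz z (\<Sum>i\<in>I. p i) = (\<Sum>i\<in>I. riesz z (p i))"
  by (induction I rule: infinite_finite_induct) (simp_all add: riesz_add)

lemma riesz_add_functional: "riesz (\<lambda>\<alpha>. y \<alpha> + z \<alpha>) p = riesz y p + riesz z p"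
  by (simp add: riesz_def distrib_left sum.distrib)

lemma rpoly_eq_sum_singles:
  "p = (\<Sum>\<alpha>\<in>Poly_Mapping.keys p. Poly_Mapping.single \<alpha> (Poly_Mapping.lookup p \<alpha>))"
proof (rule poly_mapping_eqI)
  fix \<beta>
  show "Poly_Mapping.lookup p \<beta> = Poly_Mapping.lookup
    (\<Sum>\<alpha>\<in>Poly_Mapping.keys p. Poly_Mapping.single \<alpha> (Poly_Mapping.lookup p \<alpha>)) \<beta>"
    by (simp add: lookup_sum lookup_single when_def in_keys_iff)
qed

lemma riesz_single_mult:
  "riesz z (Poly_Mapping.single \<alpha> c * q) = c * riesz (\<lambda>\<beta>. z (\<alpha> + \<beta>)) q"
proof -
  have "riesz z (Poly_Mapping.single \<alpha> c * q) = riesz z (Poly_Mapping.single \<alpha> c *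
      (\<Sum>\<beta>\<in>Poly_Mapping.keys q. Poly_Mapping.single \<beta> (Poly_Mapping.lookup q \<beta>)))"
    using rpoly_eq_sum_singles[of q] by simp
  also have "\<dots> = c * riesz (\<lambda>\<beta>. z (\<alpha> + \<beta>)) q"
    by (simp add: sum_distrib_left mult_single riesz_sum riesz_def[of _ q] mult.assoc)
  finally show ?thesis .
qed

text \<open>The nested functional is the bilinear form with entries
  \<open>z (\<alpha> + \<beta>)\<close> at the coefficient vectors of p and q. This is the link
  between matrix constraints and inequalities for \<open>riesz\<close>.\<close>

lemma riesz_mult: "riesz z (p * q) = riesz (\<lambda>\<alpha>. riesz (\<lambda>\<beta>. z (\<alpha> + \<beta>)) q) p"
proof -
  have "riesz z (p * q) = riesz z
      ((\<Sum>\<alpha>\<in>Poly_Mapping.keys p. Poly_Mapping.single \<alpha> (Poly_Mapping.lookup p \<alpha>)) * q)"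
    using rpoly_eq_sum_singles[of p] by simp
  also have "\<dots> = riesz (\<lambda>\<alpha>. riesz (\<lambda>\<beta>. z (\<alpha> + \<beta>)) q) p"
    by (simp add: sum_distrib_right riesz_sum riesz_single_mult riesz_def[of _ p])
  finally show ?thesis .
qed

lemma riesz_mult_const: "riesz (\<lambda>\<alpha>. z \<alpha> * c) p = riesz z p * c"
  by (simp add: riesz_def sum_distrib_right mult.assoc)

lemma riesz_const_mult: "riesz (\<lambda>\<alpha>. c * z \<alpha>) p = c * riesz z p"
  by (simp add: riesz_def sum_distrib_left mult_ac)

section \<open>Evaluation of polynomials at a point\<close>

lemma monom_eval_add: "monom_eval (\<alpha> + \<beta>) x = monom_eval \<alpha> x * monom_eval \<beta> x"
  by (simp add: monom_eval_def power_add prod.distrib)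

lemma monom_eval_zero [simp]: "monom_eval 0 x = 1"
  by (simp add: monom_eval_def)

lemma monom_eval_axis [simp]: "monom_eval (axis i (Suc 0)) x = x $ i"
proof -
  have "monom_eval (axis i (Suc 0)) x = (\<Prod>j\<in>UNIV. if j = i then x $ j else 1)"
    unfolding monom_eval_def by (intro prod.cong) (auto simp: axis_def)
  then show ?thesis by simp
qed

text \<open>The powers of x are the moments of the Dirac measure at x, so the algebra of evaluation
  is a special case of the algebra of \<open>riesz\<close>.\<close>

lemma rpoly_eval_eq_riesz: "rpoly_eval p x = riesz (\<lambda>\<alpha>. monom_eval \<alpha> x) p"
  by (simp add: rpoly_eval_def riesz_def)

lemma rpoly_eval_zero [simp]: "rpoly_eval 0 x = 0"
  and rpoly_eval_one [simp]: "rpoly_eval 1 x = 1"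
  and rpoly_eval_single [simp]: "rpoly_eval (Poly_Mapping.single \<alpha> c) x = c * monom_eval \<alpha> x"
  and rpoly_eval_add [simp]: "rpoly_eval (p + q) x = rpoly_eval p x + rpoly_eval q x"
  and rpoly_eval_diff [simp]: "rpoly_eval (p - q) x = rpoly_eval p x - rpoly_eval q x"
  and rpoly_eval_sum [simp]: "rpoly_eval (\<Sum>i\<in>I. P i) x = (\<Sum>i\<in>I. rpoly_eval (P i) x)"
  by (simp_all add: rpoly_eval_eq_riesz riesz_one riesz_add riesz_diff riesz_sum)

lemma rpoly_eval_uminus [simp]: "rpoly_eval (- p) x = - rpoly_eval p x"
  by (simp add: rpoly_eval_eq_riesz riesz_uminus)

lemma rpoly_eval_mult [simp]: "rpoly_eval (p * q) x = rpoly_eval p x * rpoly_eval q x"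
  by (simp add: rpoly_eval_eq_riesz riesz_mult monom_eval_add riesz_mult_const riesz_const_mult)

lemma rpoly_eval_numeral [simp]: "rpoly_eval (numeral k) x = numeral k"
  by (simp flip: single_numeral)

lemma rpoly_eval_rmonom [simp]: "rpoly_eval (rmonom \<alpha>) x = monom_eval \<alpha> x"
  by (simp add: rmonom_def)

lemma rpoly_eval_rvar [simp]: "rpoly_eval (rvar i) x = x $ i"
  by (simp add: rvar_def)

lemma rpoly_eval_power [simp]: "rpoly_eval (p ^ k) x = rpoly_eval p x ^ k"
  by (induction k) simp_all

lemma continuous_monom_eval [continuous_intros]: "continuous_on S (monom_eval \<alpha>)"
  unfolding monom_eval_def by (intro continuous_intros)

lemma continuous_rpoly_eval [continuous_intros]: "continuous_on S (rpoly_eval p)"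
  unfolding rpoly_eval_def by (intro continuous_intros)

lemma monom_eval_measurable [measurable]: "monom_eval \<alpha> \<in> borel_measurable borel"
  by (intro borel_measurable_continuous_onI continuous_intros)

lemma rpoly_eval_measurable [measurable]: "rpoly_eval p \<in> borel_measurable borel"
  by (intro borel_measurable_continuous_onI continuous_intros)

section \<open>Degree bounds through the support of a polynomial\<close>

lemma exp_deg_add: "exp_deg (\<alpha> + \<beta>) = exp_deg \<alpha> + exp_deg \<beta>"
  by (simp add: exp_deg_def sum.distrib)

lemma exp_deg_axis [simp]: "exp_deg (axis i (Suc 0)) = 1"
  by (simp add: exp_deg_def axis_def)

lemma finite_exps_upto [simp]: "finite (exps_upto k :: (nat ^ 'n::finite) set)"
proof (rule finite_subset)
  show "exps_upto k \<subseteq> (vec_lambda ` (UNIV \<rightarrow>\<^sub>E {..nat k}) :: (nat ^ 'n) set)"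
  proof
    fix \<alpha> :: "nat ^ 'n" assume "\<alpha> \<in> exps_upto k"
    then have "exp_deg \<alpha> \<le> nat k"
      by (simp add: exps_upto_def)
    then have "\<alpha> $ i \<le> nat k" for i
      using member_le_sum[of i UNIV "\<lambda>i. \<alpha> $ i"] by (simp add: exp_deg_def)
    then show "\<alpha> \<in> vec_lambda ` (UNIV \<rightarrow>\<^sub>E {..nat k})"
      by (intro image_eqI[of _ _ "vec_nth \<alpha>"]) auto
  qed
  show "finite (vec_lambda ` (UNIV \<rightarrow>\<^sub>E {..nat k}) :: (nat ^ 'n) set)"
    by (intro finite_imageI finite_PiE) auto
qed

lemma exps_upto_mono: "k \<le> l \<Longrightarrow> exps_upto k \<subseteq> exps_upto l"
  by (auto simp: exps_upto_def)

lemma rpoly_degree_bound_exists: "\<exists>k. Poly_Mapping.keys p \<subseteq> exps_upto (int k)"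
proof
  \<comment> \<open>The sum of all degrees is a crude bound, but unlike a maximum it is also defined
    for the zero polynomial.\<close>
  show "Poly_Mapping.keys p \<subseteq> exps_upto (int (\<Sum>\<alpha>\<in>Poly_Mapping.keys p. exp_deg \<alpha>))"
    by (auto simp: exps_upto_def intro!: member_le_sum simp flip: of_nat_sum)
qed

lemma keys_mult_exps_upto:
  assumes "Poly_Mapping.keys p \<subseteq> exps_upto k" "Poly_Mapping.keys q \<subseteq> exps_upto l"
  shows "Poly_Mapping.keys (p * q) \<subseteq> exps_upto (k + l)"
proof
  fix \<gamma> assume "\<gamma> \<in> Poly_Mapping.keys (p * q)"
  with keys_mult[of p q] obtain \<alpha> \<beta> where "\<gamma> = \<alpha> + \<beta>" "\<alpha> \<in> exps_upto k" "\<beta> \<in> exps_upto l"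
    using assms by blast
  then show "\<gamma> \<in> exps_upto (k + l)"
    by (simp add: exps_upto_def exp_deg_add)
qed

section \<open>Positive semidefinite matrices and nonnegativity on squares\<close>

lemma localizing_matrix_eq_riesz: "localizing_matrix g z \<alpha> \<beta> = riesz (\<lambda>\<gamma>. z (\<alpha> + \<beta> + \<gamma>)) g"
  by (simp add: localizing_matrix_def riesz_def)

lemma moment_matrix_eq_localizing: "moment_matrix z = localizing_matrix 1 z"
  by (intro ext) (simp add: moment_matrix_def localizing_matrix_eq_riesz riesz_one)

text \<open>The coefficients of p form the test vector of the quadratic form. The product is
  bracketed as \<open>p * (p * g)\<close> so that two applications of \<open>riesz_mult\<close>
  produce the matrix entries.\<close>

lemma riesz_localizing_nonneg:
  assumes psd: "psd_on (exps_upto k) (localizing_matrix g z)"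
    and p: "Poly_Mapping.keys p \<subseteq> exps_upto k"
  shows "0 \<le> riesz z (p * (p * g))"
proof -
  have "riesz z (p * (p * g)) = riesz (\<lambda>\<alpha>. riesz (\<lambda>\<beta>. localizing_matrix g z \<alpha> \<beta>) p) p"
    by (simp add: riesz_mult localizing_matrix_eq_riesz add.assoc)
  also have "\<dots> = (\<Sum>\<alpha>\<in>exps_upto k. \<Sum>\<beta>\<in>exps_upto k.
      Poly_Mapping.lookup p \<alpha> * localizing_matrix g z \<alpha> \<beta> * Poly_Mapping.lookup p \<beta>)"
    by (simp add: riesz_eq_sum_superset[OF finite_exps_upto p] sum_distrib_left mult_ac)
  finally show ?thesis
    using psd by (simp add: psd_on_def)
qed

lemma riesz_square_nonneg:
  assumes "psd_on (exps_upto k) (moment_matrix z)" "Poly_Mapping.keys p \<subseteq> exps_upto k"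
  shows "0 \<le> riesz z (p * p)"
  using riesz_localizing_nonneg[of k 1 z p] assms by (simp add: moment_matrix_eq_localizing)

lemma psd_on_localizing:
  assumes "\<And>p. Poly_Mapping.keys p \<subseteq> exps_upto k \<Longrightarrow> 0 \<le> riesz z (p * (p * g))"
  shows "psd_on (exps_upto k) (localizing_matrix g z)"
  unfolding psd_on_def
proof (intro conjI ballI allI)
  fix \<alpha> \<beta> :: "nat ^ 'a"
  show "localizing_matrix g z \<alpha> \<beta> = localizing_matrix g z \<beta> \<alpha>"
    by (simp add: localizing_matrix_eq_riesz add.commute)
next
  fix c :: "nat ^ 'a \<Rightarrow> real"
  \<comment> \<open>The test vector becomes a polynomial; its values outside the index set are cut
    off, since \<open>c\<close> is arbitrary there.\<close>
  define p where "p = (\<Sum>\<alpha>\<in>exps_upto k. Poly_Mapping.single \<alpha> (c \<alpha>))"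
  have l: "Poly_Mapping.lookup p \<beta> = (if \<beta> \<in> exps_upto k then c \<beta> else 0)" for \<beta>
    by (simp add: p_def lookup_sum lookup_single when_def)
  then have p: "Poly_Mapping.keys p \<subseteq> exps_upto k"
    by (auto simp: in_keys_iff split: if_splits)
  have "riesz z (p * (p * g)) = riesz (\<lambda>\<alpha>. riesz (\<lambda>\<beta>. localizing_matrix g z \<alpha> \<beta>) p) p"
    by (simp add: riesz_mult localizing_matrix_eq_riesz add.assoc)
  also have "\<dots> = (\<Sum>\<alpha>\<in>exps_upto k. \<Sum>\<beta>\<in>exps_upto k.
      c \<alpha> * localizing_matrix g z \<alpha> \<beta> * c \<beta>)"
    by (simp add: riesz_eq_sum_superset[OF finite_exps_upto p] sum_distrib_left l mult_ac)
  finally show "0 \<le> (\<Sum>\<alpha>\<in>exps_upto k. \<Sum>\<beta>\<in>exps_upto k.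
      c \<alpha> * localizing_matrix g z \<alpha> \<beta> * c \<beta>)"
    using assms[OF p] by simp
qed

section \<open>Partial derivatives\<close>

lemma lookup_partial_deriv:
  "Poly_Mapping.lookup (partial_deriv i p) \<beta> =
    real (\<beta> $ i + 1) * Poly_Mapping.lookup p (\<beta> + axis i 1)"
proof -
  \<comment> \<open>Two exponents can share a truncated predecessor, but only if one of them has
    i-th entry 0, and then its coefficient is 0.\<close>
  have "(if \<alpha> - axis i 1 = \<beta> then real (\<alpha> $ i) * Poly_Mapping.lookup p \<alpha> else 0) =
      (if \<alpha> = \<beta> + axis i 1 then real (\<beta> $ i + 1) * Poly_Mapping.lookup p \<alpha> else 0)" for \<alpha>
  proof (cases "\<alpha> $ i = 0")
    case True
    then have "\<alpha> \<noteq> \<beta> + axis i 1"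
      by (auto simp: axis_def)
    then show ?thesis using True by simp
  next
    case False
    then have "\<alpha> - axis i 1 = \<beta> \<longleftrightarrow> \<alpha> = \<beta> + axis i 1"
      by (auto simp: vec_eq_iff axis_def)
    then show ?thesis by auto
  qed
  then have "Poly_Mapping.lookup (partial_deriv i p) \<beta> =
      (\<Sum>\<alpha>\<in>Poly_Mapping.keys p.
        if \<alpha> = \<beta> + axis i 1 then real (\<beta> $ i + 1) * Poly_Mapping.lookup p \<alpha> else 0)"
    by (simp add: partial_deriv_def lookup_sum lookup_single when_def)
  then show ?thesis
    by (simp add: in_keys_iff)
qed

lemma has_derivative_monom_eval_axis:
  "((\<lambda>t. monom_eval \<alpha> (x + t *\<^sub>R axis i 1)) has_real_derivative
    real (\<alpha> $ i) * monom_eval (\<alpha> - axis i 1) (x + t *\<^sub>R axis i 1)) (at t)"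
proof -
  \<comment> \<open>Along the line only the i-th factor varies; \<open>c\<close> collects the
    others, which are the same for \<alpha> and for \<alpha> lowered at i.\<close>
  define c where "c = (\<Prod>j\<in>UNIV - {i}. (x $ j) ^ (\<alpha> $ j))"
  have split: "monom_eval \<beta> (x + t *\<^sub>R axis i 1) =
      (x $ i + t) ^ (\<beta> $ i) * (\<Prod>j\<in>UNIV - {i}. (x $ j) ^ (\<beta> $ j))" for \<beta> t
    unfolding monom_eval_def
    by (subst prod.remove[of _ i]) (auto simp: axis_def intro!: prod.cong)
  have c': "(\<Prod>j\<in>UNIV - {i}. (x $ j) ^ ((\<alpha> - axis i 1) $ j)) = c"
    unfolding c_def by (intro prod.cong) (auto simp: axis_def)
  show ?thesis
    unfolding split c' unfolding c_def[symmetric]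
    by (auto intro!: derivative_eq_intros simp: axis_def)
qed

lemma rpoly_eval_partial_deriv:
  "rpoly_eval (partial_deriv i p) x =
    (\<Sum>\<alpha>\<in>Poly_Mapping.keys p.
      Poly_Mapping.lookup p \<alpha> * (real (\<alpha> $ i) * monom_eval (\<alpha> - axis i 1) x))"
  by (simp add: partial_deriv_def mult_ac)

lemma has_derivative_rpoly_eval_axis:
  "((\<lambda>t. rpoly_eval p (x + t *\<^sub>R axis i 1)) has_real_derivative
    rpoly_eval (partial_deriv i p) (x + t *\<^sub>R axis i 1)) (at t)"
  unfolding rpoly_eval_partial_deriv unfolding rpoly_eval_def
  by (intro DERIV_sum DERIV_cmult has_derivative_monom_eval_axis)

section \<open>Exponentially integrable measures\<close>

text \<open>Growth is measured in this norm because its exponential is a product over the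
  coordinates, which reduces integrability to one dimension.\<close>

definition l1_norm :: "real ^ 'n::finite \<Rightarrow> real" where
  "l1_norm x = (\<Sum>i\<in>UNIV. \<bar>x $ i\<bar>)"

lemma l1_norm_nonneg: "0 \<le> l1_norm x"
  by (simp add: l1_norm_def sum_nonneg)

lemma component_le_l1_norm: "\<bar>x $ i\<bar> \<le> l1_norm x"
  unfolding l1_norm_def by (rule member_le_sum) auto

lemma l1_norm_measurable [measurable]: "l1_norm \<in> borel_measurable borel"
  unfolding l1_norm_def by (intro borel_measurable_continuous_onI continuous_intros)

text \<open>A single term of the exponential series is at most its sum.\<close>

lemma power_le_fact_exp:
  fixes y :: real
  assumes "0 \<le> y"
  shows "y ^ k \<le> fact k * exp y"
proof -
  have "(\<Sum>n\<in>{k}. y ^ n /\<^sub>R fact n) \<le> exp y"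
    unfolding exp_def by (rule sum_le_suminf[OF summable_exp_generic]) (use assms in auto)
  then show ?thesis
    by (simp add: field_simps)
qed

lemma monom_eval_exp_bound:
  fixes \<alpha> :: "nat ^ 'n::finite"
  assumes "0 < c"
  shows "\<exists>C\<ge>0. \<forall>x. \<bar>monom_eval \<alpha> x\<bar> \<le> C * exp (c * l1_norm x)"
proof (intro exI conjI allI)
  let ?C = "\<Prod>i\<in>UNIV. fact (\<alpha> $ i) / c ^ (\<alpha> $ i)"
  show "0 \<le> ?C"
    using assms by (intro prod_nonneg) auto
  fix x :: "real ^ 'n"
  have "\<bar>monom_eval \<alpha> x\<bar> = (\<Prod>i\<in>UNIV. \<bar>x $ i\<bar> ^ (\<alpha> $ i))"
    by (simp add: monom_eval_def abs_prod power_abs)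
  also have "\<dots> \<le> (\<Prod>i\<in>UNIV. fact (\<alpha> $ i) / c ^ (\<alpha> $ i) * exp (c * \<bar>x $ i\<bar>))"
  proof (intro prod_mono conjI)
    fix i
    show "\<bar>x $ i\<bar> ^ (\<alpha> $ i) \<le> fact (\<alpha> $ i) / c ^ (\<alpha> $ i) * exp (c * \<bar>x $ i\<bar>)"
      using power_le_fact_exp[of "c * \<bar>x $ i\<bar>" "\<alpha> $ i"] assms
      by (simp add: field_simps)
  qed simp
  also have "\<dots> = ?C * exp (c * l1_norm x)"
    by (simp add: l1_norm_def exp_sum sum_distrib_left flip: prod.distrib)
  finally show "\<bar>monom_eval \<alpha> x\<bar> \<le> ?C * exp (c * l1_norm x)" .
qed

lemma rpoly_eval_exp_bound:
  fixes p :: "'n::finite rpoly"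
  assumes "0 < c"
  shows "\<exists>C\<ge>0. \<forall>x. \<bar>rpoly_eval p x\<bar> \<le> C * exp (c * l1_norm x)"
proof -
  have "\<forall>\<alpha> :: nat ^ 'n. \<exists>C\<ge>0. \<forall>x. \<bar>monom_eval \<alpha> x\<bar> \<le> C * exp (c * l1_norm x)"
    using monom_eval_exp_bound[OF assms] by blast
  then obtain C where C: "\<And>\<alpha> :: nat ^ 'n. 0 \<le> C \<alpha>"
      "\<And>\<alpha> x. \<bar>monom_eval \<alpha> x\<bar> \<le> C \<alpha> * exp (c * l1_norm x)"
    by metis
  let ?C = "\<Sum>\<alpha>\<in>Poly_Mapping.keys p. \<bar>Poly_Mapping.lookup p \<alpha>\<bar> * C \<alpha>"
  have "\<bar>rpoly_eval p x\<bar> \<le> ?C * exp (c * l1_norm x)" for x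
  proof -
    have "\<bar>rpoly_eval p x\<bar> \<le> (\<Sum>\<alpha>\<in>Poly_Mapping.keys p.
        \<bar>Poly_Mapping.lookup p \<alpha> * monom_eval \<alpha> x\<bar>)"
      unfolding rpoly_eval_def by (rule sum_abs)
    also have "\<dots> \<le> (\<Sum>\<alpha>\<in>Poly_Mapping.keys p.
        \<bar>Poly_Mapping.lookup p \<alpha>\<bar> * (C \<alpha> * exp (c * l1_norm x)))"
      by (intro sum_mono) (auto simp: abs_mult intro!: mult_left_mono C)
    finally show ?thesis
      by (simp add: sum_distrib_right mult.assoc)
  qed
  moreover have "0 \<le> ?C"
    by (intro sum_nonneg) (simp add: C)
  ultimately show ?thesis by blast
qed

lemma nn_integral_exp_abs_finite:
  fixes c :: real
  assumes "0 < c"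
  shows "(\<integral>\<^sup>+x. ennreal (exp (- (c * \<bar>x\<bar>))) \<partial>lborel) < \<infinity>"
proof -
  let ?I = "\<integral>\<^sup>+x. ennreal (exp (- (c * x))) * indicator {0..} x \<partial>lborel"
  have "((\<lambda>x. - exp (- (c * x)) / c) \<longlongrightarrow> - 0 / c) at_top"
    using assms by (intro tendsto_intros filterlim_compose[OF exp_at_bot])
      (auto simp: filterlim_uminus_at_bot intro!: filterlim_tendsto_pos_mult_at_top[OF tendsto_const] filterlim_ident)
  then have "?I = ennreal (- 0 / c - (- exp (- (c * 0)) / c))"
    using assms by (intro nn_integral_FTC_atLeast) (auto intro!: derivative_eq_intros)
  then have fin: "?I < \<infinity>" by simp
  \<comment> \<open>The integrand is split at 0. The reflected half is spelled
    \<open>0 + (-1) * x\<close> to fit the affine substitution rule.\<close>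
  have "(\<integral>\<^sup>+x. ennreal (exp (- (c * \<bar>x\<bar>))) \<partial>lborel) \<le>
      (\<integral>\<^sup>+x. ennreal (exp (- (c * x))) * indicator {0..} x
        + ennreal (exp (- (c * (0 + (-1) * x)))) * indicator {0..} (0 + (-1) * x) \<partial>lborel)"
    by (intro nn_integral_mono) (auto split: split_indicator simp: abs_if)
  also have "\<dots> = ?I + (\<integral>\<^sup>+x. ennreal (exp (- (c * (0 + (-1) * x)))) * indicator {0..} (0 + (-1) * x) \<partial>lborel)"
    by (subst nn_integral_add) auto
  also have "(\<integral>\<^sup>+x. ennreal (exp (- (c * (0 + (-1) * x)))) * indicator {0..} (0 + (-1) * x) \<partial>lborel) = ?I"
    by (subst (2) nn_integral_real_affine[of _ "-1" 0]) auto
  finally show ?thesis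
    using fin by (simp add: le_less_trans)
qed

lemma integrable_exp_l1_norm:
  assumes "0 < c"
  shows "integrable lborel (\<lambda>x :: real ^ 'n::finite. exp (- (c * l1_norm x)))"
proof (rule integrableI_bounded)
  have l1: "l1_norm x = (\<Sum>b\<in>Basis. \<bar>x \<bullet> b\<bar>)" for x :: "real ^ 'n"
  proof -
    have B: "(Basis :: (real ^ 'n) set) = range (\<lambda>i. axis i 1)"
      by (auto simp: Basis_vec_def)
    show ?thesis
      unfolding B by (subst sum.reindex) (auto simp: inj_on_def axis_eq_axis l1_norm_def inner_axis)
  qed
  have "(\<integral>\<^sup>+(x :: real ^ 'n). ennreal (norm (exp (- (c * l1_norm x)))) \<partial>lborel) =
      (\<integral>\<^sup>+(x :: real ^ 'n). (\<Prod>b\<in>Basis. ennreal (exp (- (c * \<bar>x \<bullet> b\<bar>)))) \<partial>lborel)"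
    by (intro nn_integral_cong) (simp add: l1 sum_distrib_left exp_sum prod_ennreal prod_nonneg flip: sum_negf)
  also have "\<dots> = (\<Prod>b\<in>(Basis :: (real ^ 'n) set). \<integral>\<^sup>+x. ennreal (exp (- (c * \<bar>x\<bar>))) \<partial>lborel)"
    by (rule nn_integral_lborel_prod) auto
  also have "\<dots> < \<infinity>"
    using nn_integral_exp_abs_finite[OF assms] by (simp add: ennreal_prod_eq_top less_top[symmetric] power_eq_top_ennreal)
  finally show "(\<integral>\<^sup>+(x :: real ^ 'n). ennreal (norm (exp (- (c * l1_norm x)))) \<partial>lborel) < \<infinity>" .
qed simp

text \<open>This replaces the triangle inequality of L^4, so that fourth powers can be used without
  taking roots. It is the bound for squares applied twice.\<close>

lemma power4_add_le: "(a + b) ^ 4 \<le> 8 * (a ^ 4 + b ^ 4)" for a b :: real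
proof -
  have sq: "(x + y)\<^sup>2 \<le> 2 * (x\<^sup>2 + y\<^sup>2)" for x y :: real
    using sum_squares_bound[of x y] by (simp add: power2_sum)
  have "(a + b) ^ 4 = ((a + b)\<^sup>2)\<^sup>2" by (simp flip: power_mult)
  also have "\<dots> \<le> (2 * (a\<^sup>2 + b\<^sup>2))\<^sup>2"
    by (intro power_mono sq) simp
  also have "\<dots> = 4 * (a\<^sup>2 + b\<^sup>2)\<^sup>2"
    by (simp only: power_mult_distrib) simp
  also have "\<dots> \<le> 4 * (2 * ((a\<^sup>2)\<^sup>2 + (b\<^sup>2)\<^sup>2))"
    by (intro mult_left_mono sq) simp
  finally show ?thesis by (simp flip: power_mult)
qed

text \<open>The bound does not depend on \<open>N\<close>, so it can dominate all Taylor polynomials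
  of the sine at once.\<close>

lemma abs_sin_partial_sum_le: "\<bar>\<Sum>k<N. sin_coeff k * y ^ k\<bar> \<le> exp \<bar>y\<bar>"
proof -
  have "\<bar>\<Sum>k<N. sin_coeff k * y ^ k\<bar> \<le> (\<Sum>k<N. \<bar>y\<bar> ^ k /\<^sub>R fact k)"
    by (intro order_trans[OF sum_abs] sum_mono)
      (auto simp: sin_coeff_def abs_mult power_abs divide_inverse)
  also have "\<dots> \<le> exp \<bar>y\<bar>"
    unfolding exp_def by (rule sum_le_suminf[OF summable_exp_generic]) auto
  finally show ?thesis .
qed

text \<open>The instances are the reference measures with rate 1/2 and their densities by
  nonnegative polynomials with rate 1/4.\<close>

locale exp_integrable_measure =
  fixes \<nu> :: "(real ^ 'n::finite) measure" and c :: real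
  assumes sets_eq [measurable_cong]: "sets \<nu> = sets borel"
    and c_pos: "0 < c"
    and integrable_exp: "integrable \<nu> (\<lambda>x. exp (c * l1_norm x))"
begin

text \<open>Half of the rate absorbs the polynomial, the other half the exponential factor.\<close>

lemma integrable_rpoly_exp_bound:
  fixes h :: "real ^ 'n \<Rightarrow> real" and p :: "'n rpoly"
  assumes [measurable]: "h \<in> borel_measurable borel"
    and h: "\<And>x. \<bar>h x\<bar> \<le> \<bar>rpoly_eval p x\<bar> * exp (c / 2 * l1_norm x)"
  shows "integrable \<nu> h"
proof -
  obtain C where C: "0 \<le> C" "\<And>x. \<bar>rpoly_eval p x\<bar> \<le> C * exp (c / 2 * l1_norm x)"
    using rpoly_eval_exp_bound[of "c / 2" p] c_pos by auto
  show ?thesis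
  proof (rule Bochner_Integration.integrable_bound)
    show "integrable \<nu> (\<lambda>x. C * exp (c * l1_norm x))"
      by (intro integrable_mult_right integrable_exp)
    have "norm (h x) \<le> norm (C * exp (c * l1_norm x))" for x
    proof -
      have "\<bar>h x\<bar> \<le> C * exp (c / 2 * l1_norm x) * exp (c / 2 * l1_norm x)"
        by (intro order_trans[OF h] mult_right_mono C) simp
      also have "\<dots> = C * exp (c * l1_norm x)"
        by (simp add: mult.assoc flip: exp_add)
      finally show ?thesis using C by simp
    qed
    then show "AE x in \<nu>. norm (h x) \<le> norm (C * exp (c * l1_norm x))" by simp
  qed measurable
qed

lemma integrable_rpoly_bound:
  fixes h :: "real ^ 'n \<Rightarrow> real"
  assumes "h \<in> borel_measurable borel" "\<And>x. \<bar>h x\<bar> \<le> \<bar>rpoly_eval p x\<bar>"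
  shows "integrable \<nu> h"
proof (rule integrable_rpoly_exp_bound[OF assms(1)])
  fix x :: "real ^ 'n"
  have "1 \<le> exp (c / 2 * l1_norm x)"
    using c_pos l1_norm_nonneg[of x] by simp
  then show "\<bar>h x\<bar> \<le> \<bar>rpoly_eval p x\<bar> * exp (c / 2 * l1_norm x)"
    using assms(2)[of x] mult_left_mono[of 1 "exp (c / 2 * l1_norm x)" "\<bar>rpoly_eval p x\<bar>"]
    by simp
qed

lemma integrable_rpoly [simp]: "integrable \<nu> (rpoly_eval p)"
  by (rule integrable_rpoly_bound[of _ p]) auto

lemma integrable_bounded:
  fixes h :: "real ^ 'n \<Rightarrow> real"
  assumes "h \<in> borel_measurable borel" "\<And>x. \<bar>h x\<bar> \<le> B"
  shows "integrable \<nu> h"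
  using assms by (intro integrable_rpoly_bound[of h "Poly_Mapping.single 0 B"])
    (auto intro: order_trans[OF _ abs_ge_self])

lemma integrable_const [simp]: "integrable \<nu> (\<lambda>x. k :: real)"
  by (rule integrable_bounded[of _ "\<bar>k\<bar>"]) auto

text \<open>This is the L^4 closure of the polynomials. Integrability is demanded explicitly because
  the integral of a non-integrable function is 0 by convention, which would make the inequality
  meaningless.\<close>

definition approximable :: "(real ^ 'n \<Rightarrow> real) \<Rightarrow> bool" where
  "approximable F \<longleftrightarrow> F \<in> borel_measurable borel \<and>
    (\<forall>\<epsilon>>0. \<exists>q. integrable \<nu> (\<lambda>x. (F x - rpoly_eval q x) ^ 4) \<and>
      (\<integral>x. (F x - rpoly_eval q x) ^ 4 \<partial>\<nu>) < \<epsilon>)"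

text \<open>The fraction 1/16 is half of 1/8, where 8 is the constant of
  \<open>power4_add_le\<close>.\<close>

lemma integral_power4_add_less:
  fixes F G :: "real ^ 'n \<Rightarrow> real"
  assumes [measurable]: "F \<in> borel_measurable borel" "G \<in> borel_measurable borel"
    and "integrable \<nu> (\<lambda>x. F x ^ 4)" "(\<integral>x. F x ^ 4 \<partial>\<nu>) < \<epsilon> / 16"
    and "integrable \<nu> (\<lambda>x. G x ^ 4)" "(\<integral>x. G x ^ 4 \<partial>\<nu>) < \<epsilon> / 16"
  shows "integrable \<nu> (\<lambda>x. (F x + G x) ^ 4)" "(\<integral>x. (F x + G x) ^ 4 \<partial>\<nu>) < \<epsilon>"
proof -
  have int: "integrable \<nu> (\<lambda>x. 8 * (F x ^ 4 + G x ^ 4))"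
    using assms by simp
  show int': "integrable \<nu> (\<lambda>x. (F x + G x) ^ 4)"
    using power4_add_le by (intro Bochner_Integration.integrable_bound[OF int]) (auto intro!: AE_I2)
  have "(\<integral>x. (F x + G x) ^ 4 \<partial>\<nu>) \<le> (\<integral>x. 8 * (F x ^ 4 + G x ^ 4) \<partial>\<nu>)"
    by (intro integral_mono int int' power4_add_le)
  then show "(\<integral>x. (F x + G x) ^ 4 \<partial>\<nu>) < \<epsilon>"
    using assms by simp
qed

text \<open>Approximation can thus proceed in stages, through functions that are not polynomials
  themselves.\<close>

lemma approximable_closed:
  assumes [measurable]: "F \<in> borel_measurable borel"
    and close: "\<And>\<epsilon>. 0 < \<epsilon> \<Longrightarrow> \<exists>G. approximable G \<and>
      integrable \<nu> (\<lambda>x. (F x - G x) ^ 4) \<and> (\<integral>x. (F x - G x) ^ 4 \<partial>\<nu>) < \<epsilon>"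
  shows "approximable F"
  unfolding approximable_def
proof (intro conjI allI impI)
  fix \<epsilon> :: real assume "0 < \<epsilon>"
  then have "0 < \<epsilon> / 16" by simp
  from close[OF this] obtain G where G: "approximable G" "integrable \<nu> (\<lambda>x. (F x - G x) ^ 4)"
    "(\<integral>x. (F x - G x) ^ 4 \<partial>\<nu>) < \<epsilon> / 16" by blast
  from G(1) \<open>0 < \<epsilon> / 16\<close> obtain q where [measurable]: "G \<in> borel_measurable borel"
    and q: "integrable \<nu> (\<lambda>x. (G x - rpoly_eval q x) ^ 4)"
    "(\<integral>x. (G x - rpoly_eval q x) ^ 4 \<partial>\<nu>) < \<epsilon> / 16"
    unfolding approximable_def by blast
  show "\<exists>q. integrable \<nu> (\<lambda>x. (F x - rpoly_eval q x) ^ 4) \<and>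
      (\<integral>x. (F x - rpoly_eval q x) ^ 4 \<partial>\<nu>) < \<epsilon>"
    using integral_power4_add_less[OF _ _ G(2,3) q] by (intro exI[of _ q]) auto
qed fact

lemma approximable_add:
  assumes "approximable F" "approximable G"
  shows "approximable (\<lambda>x. F x + G x)"
proof -
  have [measurable]: "F \<in> borel_measurable borel" "G \<in> borel_measurable borel"
    using assms by (auto simp: approximable_def)
  have "\<exists>q. integrable \<nu> (\<lambda>x. (F x + G x - rpoly_eval q x) ^ 4) \<and>
      (\<integral>x. (F x + G x - rpoly_eval q x) ^ 4 \<partial>\<nu>) < \<epsilon>" if "0 < \<epsilon>" for \<epsilon>
  proof -
    from that have "0 < \<epsilon> / 16" by simp
    with assms obtain p q where
      p: "integrable \<nu> (\<lambda>x. (F x - rpoly_eval p x) ^ 4)"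
        "(\<integral>x. (F x - rpoly_eval p x) ^ 4 \<partial>\<nu>) < \<epsilon> / 16" and
      q: "integrable \<nu> (\<lambda>x. (G x - rpoly_eval q x) ^ 4)"
        "(\<integral>x. (G x - rpoly_eval q x) ^ 4 \<partial>\<nu>) < \<epsilon> / 16"
      unfolding approximable_def by blast
    have "(F x - rpoly_eval p x) + (G x - rpoly_eval q x) = F x + G x - rpoly_eval (p + q) x" for x
      by simp
    then show ?thesis
      using integral_power4_add_less[OF _ _ p q] by (intro exI[of _ "p + q"]) (simp only:, simp)
  qed
  then show ?thesis
    by (simp add: approximable_def)
qed

lemma approximable_rpoly: "approximable (rpoly_eval p)"
  unfolding approximable_def by (auto intro!: exI[of _ p])

text \<open>Products of approximable functions are hard to control. Asking for boundedness, and for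
  approximability against every polynomial p rather than only p = 1, gives a class that is closed
  under products.\<close>

definition multiplier :: "(real ^ 'n \<Rightarrow> real) \<Rightarrow> bool" where
  "multiplier a \<longleftrightarrow> a \<in> borel_measurable borel \<and> (\<exists>B. \<forall>x. \<bar>a x\<bar> \<le> B) \<and>
    (\<forall>p. approximable (\<lambda>x. a x * rpoly_eval p x))"

lemma multiplier_const: "multiplier (\<lambda>x. k)"
  unfolding multiplier_def
proof (intro conjI allI)
  fix p
  show "approximable (\<lambda>x. k * rpoly_eval p x)"
    using approximable_rpoly[of "Poly_Mapping.single 0 k * p"] unfolding rpoly_eval_mult[abs_def] by simp
qed auto

lemma multiplier_add:
  assumes "multiplier a" "multiplier b"
  shows "multiplier (\<lambda>x. a x + b x)"
  unfolding multiplier_def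
proof (intro conjI allI)
  fix p
  show "approximable (\<lambda>x. (a x + b x) * rpoly_eval p x)"
    using assms unfolding distrib_right by (intro approximable_add) (auto simp: multiplier_def)
next
  obtain A B where "\<And>x. \<bar>a x\<bar> \<le> A" "\<And>x. \<bar>b x\<bar> \<le> B"
    using assms by (auto simp: multiplier_def)
  then have "\<bar>a x + b x\<bar> \<le> A + B" for x
    by (meson abs_triangle_ineq add_mono order_trans)
  then show "\<exists>B. \<forall>x. \<bar>a x + b x\<bar> \<le> B" by blast
qed (use assms in \<open>auto simp: multiplier_def\<close>)

text \<open>If a polynomial r is close to a p, then b r is close to a b p because b is bounded, and
  b r is approximable because b is a multiplier.\<close>

lemma multiplier_mult:
  assumes a: "multiplier a" and b: "multiplier b"
  shows "multiplier (\<lambda>x. a x * b x)"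
proof -
  have [measurable]: "a \<in> borel_measurable borel" "b \<in> borel_measurable borel"
    using assms by (auto simp: multiplier_def)
  obtain A B where A: "\<And>x. \<bar>a x\<bar> \<le> A" and B: "\<And>x. \<bar>b x\<bar> \<le> B"
    using assms by (auto simp: multiplier_def)
  have "0 \<le> B" using B[of 0] by simp
  have "\<bar>a x * b x\<bar> \<le> A * B" for x
    unfolding abs_mult using A[of 0] by (intro mult_mono A B) auto
  moreover have "approximable (\<lambda>x. a x * b x * rpoly_eval p x)" for p
  proof (rule approximable_closed)
    fix \<epsilon> :: real assume "0 < \<epsilon>"
    then have "0 < \<epsilon> / (B ^ 4 + 1)" by (intro divide_pos_pos add_nonneg_pos) auto
    then obtain r where r: "integrable \<nu> (\<lambda>x. (a x * rpoly_eval p x - rpoly_eval r x) ^ 4)"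
        "(\<integral>x. (a x * rpoly_eval p x - rpoly_eval r x) ^ 4 \<partial>\<nu>) < \<epsilon> / (B ^ 4 + 1)"
      using a unfolding multiplier_def approximable_def by blast
    let ?h = "\<lambda>x. (a x * b x * rpoly_eval p x - b x * rpoly_eval r x) ^ 4"
    let ?k = "\<lambda>x. B ^ 4 * (a x * rpoly_eval p x - rpoly_eval r x) ^ 4"
    have le: "?h x \<le> ?k x" for x
    proof -
      have "?h x = b x ^ 4 * (a x * rpoly_eval p x - rpoly_eval r x) ^ 4"
        by (simp add: algebra_simps flip: power_mult_distrib)
      also have "\<dots> \<le> ?k x"
        using power_mono[OF B[of x], of 4] by (intro mult_right_mono) (auto simp: power_abs)
      finally show ?thesis .
    qed
    have k: "integrable \<nu> ?k" using r by simp
    have h: "integrable \<nu> ?h"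
      by (rule Bochner_Integration.integrable_bound[OF k]) (use le in auto)
    have "(\<integral>x. ?h x \<partial>\<nu>) \<le> (\<integral>x. ?k x \<partial>\<nu>)"
      by (intro integral_mono h k le)
    also have "\<dots> \<le> (B ^ 4 + 1) * (\<integral>x. (a x * rpoly_eval p x - rpoly_eval r x) ^ 4 \<partial>\<nu>)"
      by (simp add: distrib_right)
    also have "\<dots> < (B ^ 4 + 1) * (\<epsilon> / (B ^ 4 + 1))"
      by (intro mult_strict_left_mono r add_nonneg_pos) auto
    also have "\<dots> = \<epsilon>"
      using \<open>0 < \<epsilon> / (B ^ 4 + 1)\<close> by auto
    finally show "\<exists>G. approximable G \<and> integrable \<nu> (\<lambda>x. (a x * b x * rpoly_eval p x - G x) ^ 4) \<and>
        (\<integral>x. (a x * b x * rpoly_eval p x - G x) ^ 4 \<partial>\<nu>) < \<epsilon>"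
      using b h by (intro exI[of _ "\<lambda>x. b x * rpoly_eval r x"]) (auto simp: multiplier_def)
  qed measurable
  ultimately show ?thesis
    unfolding multiplier_def by auto
qed

text \<open>The Taylor polynomials of the sine converge under a dominating function. The fourth
  power of the error grows like exp (4 |s x_i|), and c/8 is the largest s for which half of the rate
  \<open>c\<close> covers this; the other half is left for p.\<close>

lemma multiplier_sin:
  assumes s: "\<bar>s\<bar> \<le> c / 8"
  shows "multiplier (\<lambda>x. sin (s * x $ i))"
proof -
  have "approximable (\<lambda>x. sin (s * x $ i) * rpoly_eval p x)" for p
    unfolding approximable_def
  proof (intro conjI allI impI)
    let ?S = "\<lambda>N x. \<Sum>k<N. sin_coeff k * (s * x $ i) ^ k"
    let ?h = "\<lambda>N x. (sin (s * x $ i) * rpoly_eval p x - ?S N x * rpoly_eval p x) ^ 4"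
    let ?w = "\<lambda>x. 16 * \<bar>rpoly_eval p x\<bar> ^ 4 * exp (c / 2 * l1_norm x)"
    have bound: "norm (?h N x) \<le> ?w x" for N x
    proof -
      have e1: "1 \<le> exp \<bar>s * x $ i\<bar>" by simp
      have "\<bar>sin (s * x $ i) - ?S N x\<bar> \<le> 2 * exp \<bar>s * x $ i\<bar>"
        using abs_sin_partial_sum_le[of "s * x $ i" N] abs_sin_le_one[of "s * x $ i"] e1
          abs_triangle_ineq4[of "sin (s * x $ i)" "?S N x"] by linarith
      then have "\<bar>sin (s * x $ i) - ?S N x\<bar> ^ 4 \<le> (2 * exp \<bar>s * x $ i\<bar>) ^ 4"
        by (intro power_mono) auto
      also have "\<dots> = 16 * exp (4 * \<bar>s * x $ i\<bar>)"
        by (simp add: power_mult_distrib flip: exp_of_nat_mult)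
      also have "4 * \<bar>s * x $ i\<bar> \<le> c / 2 * l1_norm x"
      proof -
        have "\<bar>s\<bar> * \<bar>x $ i\<bar> \<le> c / 8 * l1_norm x"
          using c_pos by (intro mult_mono s component_le_l1_norm) auto
        then show ?thesis by (simp add: abs_mult)
      qed
      finally have "\<bar>sin (s * x $ i) - ?S N x\<bar> ^ 4 \<le> 16 * exp (c / 2 * l1_norm x)" by simp
      then have "\<bar>sin (s * x $ i) - ?S N x\<bar> ^ 4 * \<bar>rpoly_eval p x\<bar> ^ 4 \<le>
          16 * exp (c / 2 * l1_norm x) * \<bar>rpoly_eval p x\<bar> ^ 4"
        by (intro mult_right_mono) auto
      then show ?thesis
        by (simp add: power_abs mult_ac abs_mult right_diff_distrib flip: power_mult_distrib)
    qed
    have w: "integrable \<nu> ?w"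
      by (rule integrable_rpoly_exp_bound[of _ "Poly_Mapping.single 0 16 * p ^ 4"])
        (auto simp: power_abs abs_mult)
    have [measurable]: "?h N \<in> borel_measurable \<nu>" for N by measurable
    have lim: "?S N x = (\<Sum>k<N. sin_coeff k *\<^sub>R (s * x $ i) ^ k)" for N x by simp
    have "(\<lambda>N. ?h N x) \<longlonglongrightarrow> (sin (s * x $ i) * rpoly_eval p x - sin (s * x $ i) * rpoly_eval p x) ^ 4" for x
      by (intro tendsto_intros, unfold lim) (use sin_converges[of "s * x $ i"] in \<open>simp add: sums_def\<close>)
    then have "(\<lambda>N. \<integral>x. ?h N x \<partial>\<nu>) \<longlonglongrightarrow> (\<integral>x. 0 \<partial>\<nu>)"
      by (intro integral_dominated_convergence[of _ _ _ ?w] w AE_I2 bound) auto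
    moreover fix \<epsilon> :: real assume "0 < \<epsilon>"
    ultimately have "\<forall>\<^sub>F N in sequentially. (\<integral>x. ?h N x \<partial>\<nu>) < \<epsilon>"
      by (intro order_tendstoD(2)) auto
    then obtain N where N: "(\<integral>x. ?h N x \<partial>\<nu>) < \<epsilon>"
      using eventually_sequentially by auto
    define q where "q = (\<Sum>k<N. Poly_Mapping.single 0 (sin_coeff k * s ^ k) * rvar i ^ k) * p"
    have q: "rpoly_eval q x = ?S N x * rpoly_eval p x" for x
      by (simp add: q_def power_mult_distrib mult_ac)
    have "integrable \<nu> (?h N)"
      by (rule Bochner_Integration.integrable_bound[OF w]) (use bound in \<open>auto intro!: AE_I2 order_trans[OF _ abs_ge_self]\<close>)
    with N show "\<exists>q. integrable \<nu> (\<lambda>x. (sin (s * x $ i) * rpoly_eval p x - rpoly_eval q x) ^ 4) \<and>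
        (\<integral>x. (sin (s * x $ i) * rpoly_eval p x - rpoly_eval q x) ^ 4 \<partial>\<nu>) < \<epsilon>"
      by (intro exI[of _ q]) (simp add: q)
  qed measurable
  then show ?thesis
    unfolding multiplier_def by (auto intro!: exI[of _ 1])
qed

lemma multiplier_sum:
  assumes "\<And>i. i \<in> I \<Longrightarrow> multiplier (a i)"
  shows "multiplier (\<lambda>x. \<Sum>i\<in>I. a i x)"
  using assms by (induction I rule: infinite_finite_induct) (auto intro: multiplier_const multiplier_add)

text \<open>Multipliers form an algebra containing constants and slow sines. The polynomial
  functions here are those of the Stone-Weierstrass theorem, whose generators are the linear
  functionals.\<close>

lemma multiplier_polynomial_of_sines:
  assumes "real_polynomial_function P" and s: "\<bar>s\<bar> \<le> c / 8"
  shows "multiplier (\<lambda>x. P (\<chi> i. sin (s * x $ i)))"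
  using assms(1)
proof (induction P rule: real_polynomial_function.induct)
  case (linear P)
  then interpret P: bounded_linear P .
  have expand: "P y = (\<Sum>i\<in>UNIV. y $ i * P (axis i 1))" for y
  proof -
    have "y = (\<Sum>i\<in>UNIV. (y $ i) *\<^sub>R axis i 1)"
      by (simp add: vec_eq_iff axis_def if_distrib[of "(*) _"] cong: if_cong)
    then have "P y = P (\<Sum>i\<in>UNIV. (y $ i) *\<^sub>R axis i 1)" by simp
    then show ?thesis by (simp add: P.sum P.scale)
  qed
  have "(\<lambda>x. P (\<chi> i. sin (s * x $ i))) = (\<lambda>x. \<Sum>i\<in>UNIV. sin (s * x $ i) * P (axis i 1))"
  proof
    fix x :: "real ^ 'n"
    show "P (\<chi> i. sin (s * x $ i)) = (\<Sum>i\<in>UNIV. sin (s * x $ i) * P (axis i 1))"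
      using expand[of "\<chi> i. sin (s * x $ i)"] by simp
  qed
  then show ?case
    by (simp only:) (intro multiplier_sum multiplier_mult multiplier_sin multiplier_const s)
qed (auto intro: multiplier_const multiplier_add multiplier_mult)

lemma tail_measure_small:
  assumes "0 < \<epsilon>"
  shows "\<exists>k::nat. (\<integral>x. indicator {x. real k < l1_norm x} x \<partial>\<nu>) < (\<epsilon> :: real)"
proof -
  have "(\<lambda>k. \<integral>x. indicator {x. real k < l1_norm x} x \<partial>\<nu>) \<longlonglongrightarrow> (\<integral>x. (0::real) \<partial>\<nu>)"
  proof (rule integral_dominated_convergence[of _ _ _ "\<lambda>x. 1 :: real"])
    show "integrable \<nu> (\<lambda>x. 1 :: real)" by (rule integrable_bounded[of _ 1]) auto
    show "AE x in \<nu>. (\<lambda>k. indicator {x. real k < l1_norm x} x) \<longlonglongrightarrow> (0::real)"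
    proof (intro AE_I2 tendsto_eventually)
      fix x
      obtain K :: nat where "l1_norm x \<le> real K" using real_arch_simple by blast
      then show "\<forall>\<^sub>F k in sequentially. indicator {x. real k < l1_norm x} x = (0::real)"
        by (intro eventually_sequentiallyI[of K]) (auto simp: indicator_def)
    qed
  qed (auto simp: indicator_def)
  then have "\<forall>\<^sub>F k in sequentially. (\<integral>x. indicator {x. real k < l1_norm x} x \<partial>\<nu>) < \<epsilon>"
    using assms by (intro order_tendstoD(2)) auto
  then show ?thesis
    using eventually_sequentially by auto
qed

text \<open>
  On \<open>\<bar>s x\<^sub>i\<bar> \<le> 1\<close> one can recover \<open>x\<^sub>i\<close> as \<open>arcsin (sin (s x\<^sub>i)) / s\<close>. A polynomial approximating
  \<open>F (arcsin y / s)\<close> on the cube \<open>[-1, 1]\<^sup>n\<close>, evaluated at \<open>y\<^sub>i = sin (s x\<^sub>i)\<close>, is therefore close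
  to \<open>F\<close> near the origin and bounded everywhere.
\<close>

lemma approximable_bounded_continuous:
  assumes F: "continuous_on UNIV F" and B: "\<And>x. \<bar>F x\<bar> \<le> B"
  shows "approximable F"
proof (rule approximable_closed)
  show [measurable]: "F \<in> borel_measurable borel"
    by (intro borel_measurable_continuous_onI F)
  fix \<epsilon> :: real assume \<epsilon>: "0 < \<epsilon>"
  define M :: real where "M = (\<integral>x. 1 \<partial>\<nu>)"
  have M: "0 \<le> M" by (simp add: M_def)
  have B0: "0 \<le> B" using B[of 0] by simp
  \<comment> \<open>The second bound makes the error near the origin cost at most \<epsilon>/2; the
    bound 1 gives \<open>\<delta> ^ 4 \<le> \<delta>\<close> and the summand 1 in
    \<open>2 * B + 1\<close> below.\<close>
  define \<delta> where "\<delta> = min 1 (\<epsilon> / (2 * (M + 1)))"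
  have \<delta>: "0 < \<delta>" "\<delta> \<le> 1" using \<epsilon> M by (auto simp: \<delta>_def)
  have "\<delta> ^ 4 \<le> \<delta>" using \<delta> power_decreasing[of 1 4 \<delta>] by simp
  then have "\<delta> ^ 4 * M \<le> \<epsilon> / (2 * (M + 1)) * M"
    using M by (intro mult_right_mono) (auto simp: \<delta>_def)
  also have "\<dots> \<le> \<epsilon> / 2"
    using M \<epsilon> by (simp add: field_simps)
  finally have \<delta>M: "\<delta> ^ 4 * M \<le> \<epsilon> / 2" .
  have "0 < \<epsilon> / (2 * (2 * B + 1) ^ 4)" using \<epsilon> B0 by simp
  from tail_measure_small[OF this] obtain k :: nat
    where k: "(\<integral>x. indicator {x. real k < l1_norm x} x \<partial>\<nu>) < \<epsilon> / (2 * (2 * B + 1) ^ 4)" by blast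
  \<comment> \<open>The bound c/8 makes the sines multipliers; the other bound keeps every s x_i
    within [-1, 1] where the l1 norm is at most k, so that arcsin inverts the sine there.\<close>
  define s where "s = min (c / 8) (1 / (real k + 1))"
  have s: "0 < s" "\<bar>s\<bar> \<le> c / 8" "s \<le> 1 / (real k + 1)" using c_pos by (auto simp: s_def)
  define K where "K = {y :: real ^ 'n. \<forall>i. -1 \<le> y $ i \<and> y $ i \<le> 1}"
  have K: "K = cbox (\<chi> i. -1) (\<chi> i. 1)" by (auto simp: K_def mem_box_cart)
  have cont: "continuous_on K (\<lambda>y. F (\<chi> i. arcsin (y $ i) / s))"
    using s by (intro continuous_on_compose2[OF F] continuous_intros) (auto simp: K_def)
  have "compact K" unfolding K by (rule compact_cbox)
  from Stone_Weierstrass_real_polynomial_function[OF this cont \<delta>(1)]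
  obtain P where P: "real_polynomial_function P"
      "\<And>y. y \<in> K \<Longrightarrow> \<bar>F (\<chi> i. arcsin (y $ i) / s) - P y\<bar> < \<delta>"
    by blast
  let ?G = "\<lambda>x :: real ^ 'n. P (\<chi> i. sin (s * x $ i))"
  have mult: "multiplier ?G" by (rule multiplier_polynomial_of_sines[OF P(1) s(2)])
  then have [measurable]: "?G \<in> borel_measurable borel" by (simp add: multiplier_def)
  from mult have "approximable (\<lambda>x. ?G x * rpoly_eval 1 x)" unfolding multiplier_def by blast
  then have appr: "approximable ?G" by simp
  have close: "\<bar>F x - ?G x\<bar> < \<delta>" if "l1_norm x \<le> real k" for x
  proof -
    have "arcsin (sin (s * x $ i)) = s * x $ i" for i
    proof -
      have "\<bar>s * x $ i\<bar> \<le> 1 / (real k + 1) * real k"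
        unfolding abs_mult using s that component_le_l1_norm[of x i] by (intro mult_mono) auto
      also have "\<dots> \<le> 1" by simp
      also have "\<dots> \<le> pi / 2" using pi_ge_two by simp
      finally show ?thesis by (intro arcsin_sin) (auto simp: abs_le_iff)
    qed
    then have "(\<chi> i. arcsin ((\<chi> i. sin (s * x $ i)) $ i) / s) = x"
      using s by (simp add: vec_eq_iff)
    then show ?thesis
      using P(2)[of "\<chi> i. sin (s * x $ i)"] by (simp add: K_def)
  qed
  \<comment> \<open>Sine vectors never leave the cube, so P is bounded by B + \<delta> on all of
    them, even where arcsin no longer recovers x.\<close>
  have far: "\<bar>F x - ?G x\<bar> \<le> 2 * B + 1" for x
  proof -
    have "(\<chi> i. sin (s * x $ i)) \<in> K" by (simp add: K_def)
    then show ?thesis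
      using P(2)[of "\<chi> i. sin (s * x $ i)"] B[of "\<chi> i. arcsin ((\<chi> i. sin (s * x $ i)) $ i) / s"] B[of x] \<delta>(2)
      by linarith
  qed
  let ?I = "\<lambda>x. indicator {x. real k < l1_norm x} x :: real"
  have le: "(F x - ?G x) ^ 4 \<le> \<delta> ^ 4 * 1 + (2 * B + 1) ^ 4 * ?I x" for x
  proof (cases "real k < l1_norm x")
    case True
    have "\<bar>F x - ?G x\<bar> ^ 4 \<le> (2 * B + 1) ^ 4" by (intro power_mono far) simp
    then show ?thesis using True \<delta> by (simp add: power_abs add_increasing)
  next
    case False
    then have "\<bar>F x - ?G x\<bar> ^ 4 \<le> \<delta> ^ 4"
      using close[of x] by (intro power_mono) auto
    then show ?thesis using False by (simp add: power_abs)
  qed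
  have I: "integrable \<nu> (\<lambda>x. 1 :: real)" "integrable \<nu> ?I"
    by (rule integrable_bounded[of _ 1]; auto simp: indicator_def)+
  have int: "integrable \<nu> (\<lambda>x. \<delta> ^ 4 * 1 + (2 * B + 1) ^ 4 * ?I x)"
    by (intro Bochner_Integration.integrable_add integrable_mult_right I)
  have int': "integrable \<nu> (\<lambda>x. (F x - ?G x) ^ 4)"
    by (rule Bochner_Integration.integrable_bound[OF int])
      (use le in \<open>auto intro!: AE_I2 order_trans[OF _ abs_ge_self]\<close>)
  have "(\<integral>x. (F x - ?G x) ^ 4 \<partial>\<nu>) \<le> (\<integral>x. \<delta> ^ 4 * 1 + (2 * B + 1) ^ 4 * ?I x \<partial>\<nu>)"
    by (intro integral_mono int int' le)
  also have "\<dots> = \<delta> ^ 4 * M + (2 * B + 1) ^ 4 * (\<integral>x. ?I x \<partial>\<nu>)"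
    unfolding M_def using I by simp
  also have "\<dots> < \<epsilon> / 2 + (2 * B + 1) ^ 4 * (\<epsilon> / (2 * (2 * B + 1) ^ 4))"
    using B0 by (intro add_le_less_mono[OF \<delta>M mult_strict_left_mono[OF k]]) simp
  also have "\<dots> = \<epsilon>"
  proof -
    have "(2 * B + 1) ^ 4 \<noteq> 0" using B0 by simp
    then show ?thesis by (simp del: power_eq_0_iff)
  qed
  finally show "\<exists>G. approximable G \<and> integrable \<nu> (\<lambda>x. (F x - G x) ^ 4) \<and>
      (\<integral>x. (F x - G x) ^ 4 \<partial>\<nu>) < \<epsilon>"
    using appr int' by (intro exI[of _ ?G]) simp
qed

text \<open>With e = F - q the difference of the squares is e (e - 2 F). Its square involves e^4,
  which is under control, and B^2 e^2, which is traded for e^4 and a small constant by Young's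
  inequality with parameter \<delta>.\<close>

lemma square_approximation:
  assumes F: "continuous_on UNIV F" and B: "\<And>x. \<bar>F x\<bar> \<le> B" and \<epsilon>: "0 < \<epsilon>"
  shows "\<exists>q. (\<integral>x. ((rpoly_eval q x)\<^sup>2 - (F x)\<^sup>2)\<^sup>2 \<partial>\<nu>) < \<epsilon>"
proof -
  define M :: real where "M = (\<integral>x. 1 \<partial>\<nu>)"
  have M: "0 \<le> M" by (simp add: M_def)
  define \<delta> where "\<delta> = \<epsilon> / (2 * (4 * B\<^sup>2 + 1) * (M + 1))"
  have \<delta>: "0 < \<delta>" using \<epsilon> M by (auto simp: \<delta>_def intro!: divide_pos_pos mult_pos_pos add_nonneg_pos)
  \<comment> \<open>This is the total coefficient of e^4 after Young's inequality.\<close>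
  define A where "A = 2 + 4 * B\<^sup>2 / \<delta>"
  have A: "0 < A" using \<delta> by (auto simp: A_def intro!: add_pos_nonneg)
  have "approximable F" by (rule approximable_bounded_continuous[OF F B])
  moreover have "0 < \<epsilon> / (2 * A)" using \<epsilon> A by simp
  ultimately obtain q where [measurable]: "F \<in> borel_measurable borel"
    and q: "integrable \<nu> (\<lambda>x. (F x - rpoly_eval q x) ^ 4)"
      "(\<integral>x. (F x - rpoly_eval q x) ^ 4 \<partial>\<nu>) < \<epsilon> / (2 * A)"
    unfolding approximable_def by blast
  have le: "((rpoly_eval q x)\<^sup>2 - (F x)\<^sup>2)\<^sup>2 \<le> 4 * B\<^sup>2 * \<delta> * 1 + A * (F x - rpoly_eval q x) ^ 4" for x
  proof -
    define e where "e = F x - rpoly_eval q x"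
    have "((rpoly_eval q x)\<^sup>2 - (F x)\<^sup>2)\<^sup>2 = e\<^sup>2 * (e - 2 * F x)\<^sup>2"
      unfolding e_def by (simp add: power2_eq_square algebra_simps)
    also have "\<dots> \<le> e\<^sup>2 * (2 * e\<^sup>2 + 8 * B\<^sup>2)"
    proof (intro mult_left_mono)
      have "(F x)\<^sup>2 \<le> B\<^sup>2" using power_mono[OF B[of x], of 2] by simp
      moreover have "0 \<le> (e + 2 * F x)\<^sup>2" by simp
      ultimately show "(e - 2 * F x)\<^sup>2 \<le> 2 * e\<^sup>2 + 8 * B\<^sup>2"
        by (simp add: power2_eq_square algebra_simps)
    qed simp
    also have "\<dots> = 2 * e ^ 4 + 8 * B\<^sup>2 * e\<^sup>2"
      by (simp add: algebra_simps flip: power_add)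
    also have "\<dots> \<le> 2 * e ^ 4 + 8 * B\<^sup>2 * ((\<delta> + e ^ 4 / \<delta>) / 2)"
    proof (intro add_left_mono mult_left_mono)
      have "0 \<le> (\<delta> - e\<^sup>2)\<^sup>2" by simp
      then have "2 * \<delta> * e\<^sup>2 \<le> \<delta>\<^sup>2 + e ^ 4" by (simp add: power2_diff flip: power_mult)
      then show "e\<^sup>2 \<le> (\<delta> + e ^ 4 / \<delta>) / 2"
        using \<delta> by (simp add: field_simps power2_eq_square)
    qed simp
    also have "\<dots> = 4 * B\<^sup>2 * \<delta> * 1 + A * e ^ 4"
      by (simp add: A_def algebra_simps)
    finally show ?thesis by (simp add: e_def)
  qed
  have I: "integrable \<nu> (\<lambda>x. 1 :: real)" by (rule integrable_bounded[of _ 1]) auto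
  have int: "integrable \<nu> (\<lambda>x. 4 * B\<^sup>2 * \<delta> * 1 + A * (F x - rpoly_eval q x) ^ 4)"
    by (intro Bochner_Integration.integrable_add integrable_mult_right I q)
  have int': "integrable \<nu> (\<lambda>x. ((rpoly_eval q x)\<^sup>2 - (F x)\<^sup>2)\<^sup>2)"
    by (rule Bochner_Integration.integrable_bound[OF int])
      (use le in \<open>auto intro!: AE_I2 order_trans[OF _ abs_ge_self]\<close>)
  have "(\<integral>x. ((rpoly_eval q x)\<^sup>2 - (F x)\<^sup>2)\<^sup>2 \<partial>\<nu>) \<le>
      (\<integral>x. 4 * B\<^sup>2 * \<delta> * 1 + A * (F x - rpoly_eval q x) ^ 4 \<partial>\<nu>)"
    by (intro integral_mono int int' le)
  also have "\<dots> = 4 * B\<^sup>2 * \<delta> * M + A * (\<integral>x. (F x - rpoly_eval q x) ^ 4 \<partial>\<nu>)"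
    unfolding M_def using q by simp
  also have "\<dots> < \<epsilon> / 2 + A * (\<epsilon> / (2 * A))"
  proof (rule add_le_less_mono[OF _ mult_strict_left_mono[OF q(2) A]])
    have "4 * B\<^sup>2 * \<delta> * M \<le> (4 * B\<^sup>2 + 1) * \<delta> * (M + 1)"
      using \<delta> M by (intro mult_mono) auto
    also have "\<dots> = \<epsilon> / 2"
    proof -
      have "4 * B\<^sup>2 + 1 > 0" by (intro add_nonneg_pos) auto
      then have "4 * B\<^sup>2 + 1 \<noteq> 0" "M + 1 \<noteq> 0" using M by linarith+
      moreover have "b * (\<epsilon> / (2 * b * m)) * m = \<epsilon> / 2" if "b \<noteq> 0" "m \<noteq> 0" for b m :: real
        using that by (simp add: field_simps)
      ultimately show ?thesis unfolding \<delta>_def by blast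
    qed
    finally show "4 * B\<^sup>2 * \<delta> * M \<le> \<epsilon> / 2" .
  qed
  also have "\<dots> = \<epsilon>" using A by simp
  finally show ?thesis ..
qed

end

section \<open>Zero sets of polynomials\<close>

lemma emeasure_lborel_translate_vimage:
  fixes a :: "'a::euclidean_space"
  assumes "S \<in> sets borel"
  shows "emeasure lborel {x. a + x \<in> S} = emeasure lborel S"
proof -
  have "emeasure lborel S = emeasure (distr lborel borel ((+) a)) S"
    by (simp add: lborel_distr_plus)
  also have "\<dots> = emeasure lborel ((+) a -` S \<inter> space lborel)"
    using assms by (intro emeasure_distr) auto
  finally show ?thesis by (simp add: vimage_def)
qed

text \<open>
  Points of such a set can be uniformly separated on each line after splitting it into countably
  many pieces; each bounded piece then has infinitely many disjoint translates in a bounded set.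
\<close>

lemma right_isolated_on_lines_null:
  fixes A :: "'a::euclidean_space set"
  assumes A [measurable]: "A \<in> sets borel" and e: "norm e \<le> 1"
    and isolated: "\<And>x. x \<in> A \<Longrightarrow> \<exists>\<tau>>0. \<forall>t. 0 < t \<and> t < \<tau> \<longrightarrow> x + t *\<^sub>R e \<notin> A"
  shows "A \<in> null_sets lborel"
proof -
  define \<rho> where "\<rho> k = 1 / real (Suc k)" for k
  \<comment> \<open>Only rational steps are tested, so that \<open>D k\<close> is Borel.\<close>
  define D where "D k = {x. x \<in> A \<and> norm x \<le> real k \<and>
    (\<forall>q\<in>\<rat>. 0 < q \<and> q < \<rho> k \<longrightarrow> x + q *\<^sub>R e \<notin> A)}" for k
  have D_meas: "D k \<in> sets borel" for k
    unfolding D_def by (measurable; simp add: countable_rat)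
  have "D k \<in> null_sets lborel" for k
  proof -
    \<comment> \<open>The shifts are distinct rationals in (0, \<rho> k), so any two differ by a
      rational step that \<open>D k\<close> forbids, and the translates are disjoint.\<close>
    define q where "q j = \<rho> k / real (j + 2)" for j
    have \<rho>: "0 < \<rho> k" "\<rho> k \<le> 1" "\<rho> k \<in> \<rat>" by (auto simp: \<rho>_def)
    have q: "q j \<in> \<rat>" "0 < q j" "q j < \<rho> k" for j
      using \<rho> mult_strict_left_mono[of 1 "real (j + 2)" "\<rho> k"]
      by (auto simp: q_def divide_less_eq simp del: of_nat_add)
    have "inj q" using \<rho> by (auto simp: inj_def q_def)
    define P where "P j = {x. q j *\<^sub>R e + x \<in> D k}" for j
    have P_meas: "P j \<in> sets borel" for j
      unfolding P_def using D_meas by measurable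
    have emP: "emeasure lborel (P j) = emeasure lborel (D k)" for j
      unfolding P_def by (rule emeasure_lborel_translate_vimage[OF D_meas])
    have disj: False if x: "x \<in> P i" "x \<in> P j" and ij: "q i < q j" for x i j
    proof -
      have "(q i *\<^sub>R e + x) + (q j - q i) *\<^sub>R e = q j *\<^sub>R e + x"
        by (simp add: algebra_simps)
      moreover have "q j - q i \<in> \<rat>" "0 < q j - q i" "q j - q i < \<rho> k"
        using q(1)[of i] q(1)[of j] q(2)[of i] q(3)[of j] ij by (auto intro: Rats_diff)
      ultimately show False
        using x unfolding P_def D_def by (metis (mono_tags, lifting) mem_Collect_eq)
    qed
    then have disjoint: "disjoint_family P"
      unfolding disjoint_family_on_def using \<open>inj q\<close>
      by (metis (no_types, lifting) disjoint_iff injD linorder_neqE_linordered_idom)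
    have sub: "P j \<subseteq> cball 0 (real k + 1)" for j
    proof
      fix x assume "x \<in> P j"
      then have "norm (q j *\<^sub>R e + x) \<le> real k" by (simp add: P_def D_def)
      moreover have "norm (q j *\<^sub>R e) \<le> 1"
        using q[of j] \<rho> e mult_mono[of "q j" 1 "norm e" 1] by auto
      ultimately show "x \<in> cball 0 (real k + 1)"
        using norm_triangle_ineq4[of "q j *\<^sub>R e + x" "q j *\<^sub>R e"] by simp
    qed
    have fin: "emeasure lborel (cball 0 (real k + 1) :: 'a set) < \<infinity>"
      by (intro emeasure_bounded_finite) auto
    have finP: "emeasure lborel (P j) \<noteq> \<infinity>" for j
      using emeasure_mono[OF sub[of j], of lborel] fin by (auto simp: top_unique)
    \<comment> \<open>N disjoint copies of equal measure fit into one ball for every N, which forces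
      measure 0.\<close>
    have "real N * measure lborel (D k) \<le> measure lborel (cball 0 (real k + 1) :: 'a set)" for N
    proof -
      have "measure lborel (\<Union>j<N. P j) = (\<Sum>j<N. measure lborel (P j))"
        using disjoint P_meas finP
        by (intro measure_finite_Union) (auto simp: disjoint_family_on_def)
      also have "\<dots> = real N * measure lborel (D k)"
        by (simp add: measure_def emP)
      finally have "real N * measure lborel (D k) = measure lborel (\<Union>j<N. P j)" by simp
      also have "\<dots> \<le> measure lborel (cball 0 (real k + 1) :: 'a set)"
        using sub fin P_meas by (intro measure_mono_fmeasurable) (auto simp: fmeasurable_def intro!: sets.finite_UN)
      finally show ?thesis .
    qed
    then have "measure lborel (D k) = 0"
      using reals_Archimedean3 by (metis less_le_not_le measure_nonneg order_le_less)
    then show ?thesis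
      using D_meas finP[of 0] by (auto simp: null_sets_def emP measure_eq_emeasure_eq_ennreal
          emeasure_eq_ennreal_measure)
  qed
  then have "(\<Union>k. D k) \<in> null_sets lborel" by (intro null_sets_UN)
  moreover have "A \<subseteq> (\<Union>k. D k)"
  proof
    fix x assume x: "x \<in> A"
    from isolated[OF x] obtain \<tau> where \<tau>: "0 < \<tau>" "\<And>t. 0 < t \<Longrightarrow> t < \<tau> \<Longrightarrow> x + t *\<^sub>R e \<notin> A" by blast
    obtain k :: nat where k: "max (norm x) (1 / \<tau>) \<le> real k" using real_arch_simple by blast
    have "1 / \<tau> \<le> real (Suc k)" using k by simp
    then have "\<rho> k \<le> \<tau>" using \<tau>(1) by (simp add: \<rho>_def field_simps)
    then have "x \<in> D k" using x k \<tau>(2) by (auto simp: D_def)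
    then show "x \<in> (\<Union>k. D k)" by blast
  qed
  ultimately show ?thesis
    using null_sets_subset[of "\<Union>k. D k" lborel A] A by simp
qed

text \<open>Induction on a degree bound. An exponent of positive degree yields a variable whose
  partial derivative is a nonzero polynomial of smaller degree. Where that derivative vanishes the
  induction hypothesis applies; where it does not, zeros are isolated to the right on lines in that
  direction.\<close>

lemma rpoly_zero_set_null:
  fixes f :: "'n::finite rpoly"
  assumes "f \<noteq> 0"
  shows "{x. rpoly_eval f x = 0} \<in> null_sets lborel"
proof -
  have "{x. rpoly_eval f x = 0} \<in> null_sets lborel"
    if "f \<noteq> 0" "Poly_Mapping.keys f \<subseteq> exps_upto (int d)" for f :: "'n rpoly" and d
    using that
  proof (induction d arbitrary: f)
    case 0
    have "Poly_Mapping.keys f \<subseteq> {0}"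
      using 0(2) by (auto simp: exps_upto_def exp_deg_def vec_eq_iff subset_iff simp del: of_nat_sum)
    moreover have "Poly_Mapping.keys f \<noteq> {}"
      using 0(1) rpoly_eq_sum_singles[of f] by auto
    ultimately have k: "Poly_Mapping.keys f = {0}" by blast
    then have "Poly_Mapping.lookup f 0 \<noteq> 0" by (simp flip: in_keys_iff)
    then have "{x. rpoly_eval f x = 0} = {}" by (simp add: rpoly_eval_def k)
    then show ?case by simp
  next
    case (Suc d)
    show ?case
    proof (cases "Poly_Mapping.keys f \<subseteq> exps_upto (int d)")
      case True
      then show ?thesis using Suc by blast
    next
      case False
      then obtain \<alpha> where \<alpha>: "\<alpha> \<in> Poly_Mapping.keys f" "exp_deg \<alpha> > d"
        unfolding exps_upto_def by fastforce
      then have "exp_deg \<alpha> \<noteq> 0" by auto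
      then obtain i where i: "\<alpha> $ i \<noteq> 0" by (auto simp: exp_deg_def)
      let ?g = "partial_deriv i f"
      have "\<alpha> - axis i 1 + axis i 1 = \<alpha>" using i by (auto simp: vec_eq_iff axis_def)
      then have "Poly_Mapping.lookup ?g (\<alpha> - axis i 1) \<noteq> 0"
        using \<alpha>(1) by (simp add: lookup_partial_deriv in_keys_iff del: One_nat_def)
      then have "?g \<noteq> 0" by auto
      moreover have "Poly_Mapping.keys ?g \<subseteq> exps_upto (int d)"
      proof
        fix \<beta> assume "\<beta> \<in> Poly_Mapping.keys ?g"
        then have "\<beta> + axis i 1 \<in> Poly_Mapping.keys f"
          by (auto simp: in_keys_iff lookup_partial_deriv)
        then have "\<beta> + axis i 1 \<in> exps_upto (int (Suc d))" using Suc.prems by blast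
        then show "\<beta> \<in> exps_upto (int d)" by (simp add: exps_upto_def exp_deg_add)
      qed
      ultimately have g: "{x. rpoly_eval ?g x = 0} \<in> null_sets lborel" by (rule Suc.IH)
      define A where "A = {x. rpoly_eval f x = 0 \<and> rpoly_eval ?g x \<noteq> 0}"
      have "A \<in> null_sets lborel"
      proof (rule right_isolated_on_lines_null)
        show "A \<in> sets borel" unfolding A_def by measurable
        show "norm (axis i 1 :: real ^ 'n) \<le> 1" by simp
        fix x assume x: "x \<in> A"
        let ?\<phi> = "\<lambda>t. rpoly_eval f (x + t *\<^sub>R axis i 1)"
        have der: "(?\<phi> has_real_derivative rpoly_eval ?g x) (at 0)"
          using has_derivative_rpoly_eval_axis[of f x i 0] by simp
        show "\<exists>\<tau>>0. \<forall>t. 0 < t \<and> t < \<tau> \<longrightarrow> x + t *\<^sub>R axis i 1 \<notin> A"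
        proof (cases "rpoly_eval ?g x > 0")
          case True
          with DERIV_pos_inc_right[OF der] show ?thesis using x by (fastforce simp: A_def)
        next
          case False
          then have "rpoly_eval ?g x < 0" using x by (auto simp: A_def)
          with DERIV_neg_dec_right[OF der] show ?thesis using x by (fastforce simp: A_def)
        qed
      qed
      then have "A \<union> {x. rpoly_eval ?g x = 0} \<in> null_sets lborel" using g by (rule null_sets.Un)
      moreover have "{x. rpoly_eval f x = 0} \<subseteq> A \<union> {x. rpoly_eval ?g x = 0}"
        by (auto simp: A_def)
      moreover have "{x. rpoly_eval f x = 0} \<in> sets lborel" by measurable
      ultimately show ?thesis by (blast intro: null_sets_subset)
    qed
  qed
  then show ?thesis
    using rpoly_degree_bound_exists[of f] assms by blast
qed

section \<open>Integration by parts on a set with vanishing boundary values\<close>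

text \<open>The segment leaves K, so it meets the frontier. Up to the first such point it stays in
  K, where the derivative is bounded, and at that point h is 0; the mean value inequality does the
  rest.\<close>

lemma abs_le_of_segment_leaving:
  fixes K :: "'a::real_normed_vector set"
  assumes K: "closed K" and zero: "\<And>y. y \<in> frontier K \<Longrightarrow> h y = (0::real)"
    and der: "\<And>t. ((\<lambda>t. h (x + t *\<^sub>R e)) has_real_derivative h' (x + t *\<^sub>R e)) (at t)"
    and bound: "\<And>t. 0 \<le> t \<Longrightarrow> t \<le> \<tau> \<Longrightarrow> x + t *\<^sub>R e \<in> K \<Longrightarrow> \<bar>h' (x + t *\<^sub>R e)\<bar> \<le> B"
    and x: "x \<in> K" and \<tau>: "0 \<le> \<tau>" "x + \<tau> *\<^sub>R e \<notin> K"
  shows "\<bar>h x\<bar> \<le> \<tau> * B"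
proof -
  let ?l = "\<lambda>t. x + t *\<^sub>R e"
  have exit: "\<exists>c\<in>{0..\<sigma>}. ?l c \<in> frontier K" if "0 \<le> \<sigma>" "?l \<sigma> \<notin> K" for \<sigma>
  proof -
    have "connected (?l ` {0..\<sigma>})"
      by (intro connected_continuous_image continuous_intros) auto
    moreover have "?l ` {0..\<sigma>} \<inter> K \<noteq> {}" using x that(1) by (force intro!: image_eqI[of _ _ 0])
    moreover have "?l ` {0..\<sigma>} - K \<noteq> {}" using that by force
    ultimately have "?l ` {0..\<sigma>} \<inter> frontier K \<noteq> {}" by (rule connected_Int_frontier)
    then show ?thesis by blast
  qed
  define Z where "Z = {0..\<tau>} \<inter> ?l -` frontier K"
  have "compact Z"
    unfolding Z_def by (intro compact_Int_closed continuous_closed_vimage continuous_intros) auto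
  moreover have "Z \<noteq> {}" using exit[OF \<tau>] by (auto simp: Z_def)
  ultimately have "\<exists>c\<in>Z. \<forall>z\<in>Z. c \<le> z" by (rule compact_attains_inf)
  then obtain c where c: "c \<in> Z" "\<And>z. z \<in> Z \<Longrightarrow> c \<le> z" by blast
  have cK: "?l c \<in> K" using c(1) K frontier_subset_closed by (auto simp: Z_def)
  have inK: "?l \<sigma> \<in> K" if "0 \<le> \<sigma>" "\<sigma> \<le> c" for \<sigma>
  proof (rule ccontr)
    assume "?l \<sigma> \<notin> K"
    with exit[OF that(1)] obtain z where "0 \<le> z" "z \<le> \<sigma>" "?l z \<in> frontier K" by auto
    then have "z \<in> Z" using that c(1) by (auto simp: Z_def)
    then have "\<sigma> = c" using c(2) \<open>z \<le> \<sigma>\<close> that(2) by force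
    then show False using \<open>?l \<sigma> \<notin> K\<close> cK by simp
  qed
  have c0: "0 \<le> c" "c \<le> \<tau>" using c(1) by (auto simp: Z_def)
  have "norm (h (?l c) - h (?l 0)) \<le> B * norm (c - 0)"
  proof (rule field_differentiable_bound[of "{0..c}" "\<lambda>t. h (?l t)" "\<lambda>t. h' (?l t)"])
    fix t assume t: "t \<in> {0..c}"
    show "((\<lambda>t. h (?l t)) has_field_derivative h' (?l t)) (at t within {0..c})"
      using der by (rule has_field_derivative_at_within)
    show "norm (h' (?l t)) \<le> B" using bound[of t] inK[of t] t c0 by auto
  qed (use c0 in auto)
  moreover have "h (?l c) = 0" using c(1) zero by (auto simp: Z_def)
  moreover have "0 \<le> B" using bound[of 0] x \<tau> by fastforce
  ultimately show ?thesis
    using c0 mult_right_mono[of c \<tau> B] by (simp add: mult.commute)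
qed

text \<open>
  Since \<open>h\<close> vanishes on the boundary, its extension by zero outside of \<open>K\<close> is Lipschitz along lines,
  and the difference quotients, whose integrals vanish by translation invariance, converge
  dominatedly.
\<close>

lemma integral_directional_derivative_eq_0:
  fixes K :: "'a::euclidean_space set" and h h' W :: "'a \<Rightarrow> real"
  assumes K: "closed K" and null: "frontier K \<in> null_sets lborel"
    and zero: "\<And>y. y \<in> frontier K \<Longrightarrow> h y = 0"
    and [measurable]: "h \<in> borel_measurable borel" "h' \<in> borel_measurable borel"
    and der: "\<And>x t. ((\<lambda>t. h (x + t *\<^sub>R e)) has_real_derivative h' (x + t *\<^sub>R e)) (at t)"
    and bound: "\<And>x t. \<bar>t\<bar> \<le> 1 \<Longrightarrow> x + t *\<^sub>R e \<in> K \<Longrightarrow> \<bar>h' (x + t *\<^sub>R e)\<bar> \<le> W x"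
    and W: "integrable lborel W" "\<And>x. 0 \<le> W x"
    and h: "integrable lborel (\<lambda>x. indicator K x * h x)"
  shows "(\<integral>x. indicator K x * h' x \<partial>lborel) = 0"
proof -
  have [measurable]: "K \<in> sets borel" using K by simp
  define H where "H x = indicator K x * h x" for x
  have [measurable]: "H \<in> borel_measurable borel" unfolding H_def by measurable
  \<comment> \<open>If the segment stays in K, this is the mean value inequality. Otherwise the two
    end values are bounded separately by t W x, whence the factor 2.\<close>
  have lip: "\<bar>H (x + t *\<^sub>R e) - H x\<bar> \<le> 2 * t * W x" if t: "0 \<le> t" "t \<le> 1" for x t
  proof (cases "\<forall>s\<in>{0..t}. x + s *\<^sub>R e \<in> K")
    case True
    have "norm (h (x + t *\<^sub>R e) - h (x + 0 *\<^sub>R e)) \<le> W x * norm (t - 0)"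
    proof (rule field_differentiable_bound[of "{0..t}" "\<lambda>t. h (x + t *\<^sub>R e)" "\<lambda>t. h' (x + t *\<^sub>R e)"])
      fix s assume s: "s \<in> {0..t}"
      show "((\<lambda>t. h (x + t *\<^sub>R e)) has_field_derivative h' (x + s *\<^sub>R e)) (at s within {0..t})"
        using der by (rule has_field_derivative_at_within)
      show "norm (h' (x + s *\<^sub>R e)) \<le> W x" using bound[of s x] True s t by auto
    qed (use t in auto)
    moreover have "x \<in> K" "x + t *\<^sub>R e \<in> K"
      using True[rule_format, of 0] True[rule_format, of t] t by auto
    moreover have "0 \<le> W x * t" using W t by simp
    ultimately show ?thesis using t by (simp add: H_def mult_ac)
  next
    case False
    then obtain s where s: "0 \<le> s" "s \<le> t" "x + s *\<^sub>R e \<notin> K" by auto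
    have "\<bar>H x\<bar> \<le> t * W x"
    proof (cases "x \<in> K")
      case True
      have "\<bar>h x\<bar> \<le> s * W x"
        using s t by (intro abs_le_of_segment_leaving[OF K zero der _ True] bound) auto
      also have "\<dots> \<le> t * W x" using s W by (intro mult_right_mono) auto
      finally show ?thesis using True by (simp add: H_def)
    qed (use W t in \<open>simp add: H_def\<close>)
    moreover have "\<bar>H (x + t *\<^sub>R e)\<bar> \<le> t * W x"
    proof (cases "x + t *\<^sub>R e \<in> K")
      case True
      have reversed: "x + t *\<^sub>R e + r *\<^sub>R (- e) = x + (t - r) *\<^sub>R e" for r
        by (simp add: algebra_simps)
      \<comment> \<open>The same estimate from the far end, travelling backwards; t - s is the time
        needed to reach the known point outside K.\<close>
      have "\<bar>h (x + t *\<^sub>R e)\<bar> \<le> (t - s) * W x"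
      proof (rule abs_le_of_segment_leaving[where e = "- e" and h' = "\<lambda>y. - h' y", OF K zero _ _ True])
        fix r
        have "((\<lambda>r. t - r) has_real_derivative -1) (at r)"
          by (auto intro!: derivative_eq_intros)
        from DERIV_chain2[OF der this]
        show "((\<lambda>r. h (x + t *\<^sub>R e + r *\<^sub>R (- e))) has_real_derivative - h' (x + t *\<^sub>R e + r *\<^sub>R (- e))) (at r)"
          unfolding reversed by simp
        show "\<bar>- h' (x + t *\<^sub>R e + r *\<^sub>R (- e))\<bar> \<le> W x"
          if "0 \<le> r" "r \<le> t - s" "x + t *\<^sub>R e + r *\<^sub>R (- e) \<in> K"
          using that bound[of "t - r" x] s t unfolding reversed by auto
      qed (use s in \<open>simp_all add: algebra_simps\<close>)
      also have "\<dots> \<le> t * W x" using s W by (intro mult_right_mono) auto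
      finally show ?thesis using True by (simp add: H_def)
    qed (use W t in \<open>simp add: H_def\<close>)
    ultimately show ?thesis by simp
  qed
  define \<tau> where "\<tau> n = 1 / real (Suc n)" for n
  have \<tau>: "0 < \<tau> n" "\<tau> n \<le> 1" for n by (auto simp: \<tau>_def)
  have \<tau>0: "\<tau> \<longlonglongrightarrow> 0" unfolding \<tau>_def by (rule LIMSEQ_Suc[OF lim_const_over_n])
  have H: "integrable lborel H" unfolding H_def[abs_def] by (rule h)
  define D where "D n x = (H (x + \<tau> n *\<^sub>R e) - H x) / \<tau> n" for n x
  have trans: "integrable lborel (\<lambda>x. H (x + a))" "(\<integral>x. H (x + a) \<partial>lborel) = (\<integral>x. H x \<partial>lborel)" for a
  proof -
    have "integrable (distr lborel borel ((+) a)) H" using H by (simp add: lborel_distr_plus)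
    then show "integrable lborel (\<lambda>x. H (x + a))" by (subst (asm) integrable_distr_eq) (auto simp: add.commute)
    have "(\<integral>x. H x \<partial>lborel) = (\<integral>x. H x \<partial>distr lborel borel ((+) a))" by (simp add: lborel_distr_plus)
    also have "\<dots> = (\<integral>x. H (x + a) \<partial>lborel)" by (subst integral_distr) (auto simp: add.commute)
    finally show "(\<integral>x. H (x + a) \<partial>lborel) = (\<integral>x. H x \<partial>lborel)" by simp
  qed
  have "(\<integral>x. D n x \<partial>lborel) = 0" for n
    unfolding D_def using trans H by simp
  moreover have "(\<lambda>n. \<integral>x. D n x \<partial>lborel) \<longlonglongrightarrow> (\<integral>x. indicator K x * h' x \<partial>lborel)"
  proof (rule integral_dominated_convergence)
    show "integrable lborel (\<lambda>x. 2 * W x)" using W by simp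
    show "AE x in lborel. norm (D n x) \<le> 2 * W x" for n
    proof (rule AE_I2)
      fix x
      show "norm (D n x) \<le> 2 * W x"
        using lip[of "\<tau> n" x] \<tau>[of n] by (simp add: D_def abs_divide field_simps)
    qed
    \<comment> \<open>Off the frontier x is interior to K or to its complement, so
      \<open>D n x\<close> is eventually a difference quotient of h or eventually 0.\<close>
    have "AE x in lborel. x \<notin> frontier K" by (rule AE_not_in[OF null])
    then show "AE x in lborel. (\<lambda>n. D n x) \<longlonglongrightarrow> indicator K x * h' x"
    proof (eventually_elim)
      case (elim x)
      have lim: "(\<lambda>n. x + \<tau> n *\<^sub>R e) \<longlonglongrightarrow> x"
        using tendsto_add[OF tendsto_const tendsto_scaleR[OF \<tau>0 tendsto_const], of x e] by simp
      show ?case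
      proof (cases "x \<in> K")
        case True
        with elim have "x \<in> interior K" by (simp add: frontier_def K closure_closed)
        then have "\<forall>\<^sub>F n in sequentially. x + \<tau> n *\<^sub>R e \<in> interior K"
          using lim by (intro topological_tendstoD) auto
        then have ev: "\<forall>\<^sub>F n in sequentially. (h (x + \<tau> n *\<^sub>R e) - h x) / \<tau> n = D n x"
        proof eventually_elim
          case (elim n)
          then have "x + \<tau> n *\<^sub>R e \<in> K" using interior_subset by blast
          then show ?case using True by (simp add: D_def H_def)
        qed
        have "((\<lambda>t. (h (x + t *\<^sub>R e) - h x) / t) \<longlongrightarrow> h' x) (at 0)"
          using der[of x 0] by (simp add: has_field_derivative_iff)
        moreover have "filterlim \<tau> (at 0) sequentially"
          unfolding filterlim_at using \<tau>0 \<tau>(1) by (auto intro!: always_eventually simp: less_imp_neq[symmetric])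
        ultimately have "(\<lambda>n. (h (x + \<tau> n *\<^sub>R e) - h x) / \<tau> n) \<longlonglongrightarrow> h' x"
          by (rule filterlim_compose)
        with ev have "(\<lambda>n. D n x) \<longlonglongrightarrow> h' x" by (blast intro: Lim_transform_eventually)
        then show ?thesis using True by simp
      next
        case False
        then have "\<forall>\<^sub>F n in sequentially. x + \<tau> n *\<^sub>R e \<in> - K"
          using lim K by (intro topological_tendstoD) auto
        then have "\<forall>\<^sub>F n in sequentially. D n x = 0"
          by eventually_elim (use False in \<open>auto simp: D_def H_def\<close>)
        then show ?thesis using False by (simp add: tendsto_eventually)
      qed
    qed
    show "D n \<in> borel_measurable lborel" for n unfolding D_def by measurable
  qed measurable
  ultimately show ?thesis
    by (simp add: LIMSEQ_const_iff)
qed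

section \<open>The Gaussian and exponential measures\<close>

definition ref_supp :: "measure_kind \<Rightarrow> (real ^ 'n::finite) set" where
  "ref_supp \<kappa> = (case \<kappa> of Gaussian \<Rightarrow> UNIV | Exponential \<Rightarrow> nonneg_orthant)"

text \<open>The density without the indicator of the support: smooth and positive everywhere, so it
  can be differentiated along any line, including lines that leave the support.\<close>

definition ref_weight :: "measure_kind \<Rightarrow> real ^ 'n::finite \<Rightarrow> real" where
  "ref_weight \<kappa> x = (2 * pi) powr (- real CARD('n) / 2) *
    exp (- (case \<kappa> of Gaussian \<Rightarrow> (norm x)\<^sup>2 / 2 | Exponential \<Rightarrow> (\<Sum>i\<in>UNIV. x $ i)))"

lemma measure_support_ref_measure: "measure_support (ref_measure \<kappa>) = ref_supp \<kappa>"
  by (cases \<kappa>) (simp_all add: ref_supp_def measure_support_Gaussian measure_support_Exponential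
    del: ref_measure.simps)

lemma closed_ref_supp: "closed (ref_supp \<kappa>)"
  by (cases \<kappa>) (simp_all add: ref_supp_def closed_nonneg_orthant)

lemma ref_supp_measurable [measurable]: "ref_supp \<kappa> \<in> sets borel"
  by (rule borel_closed[OF closed_ref_supp])

lemma ref_weight_measurable [measurable]: "ref_weight \<kappa> \<in> borel_measurable borel"
  unfolding ref_weight_def by (cases \<kappa>) simp_all

lemma ref_weight_pos: "0 < ref_weight \<kappa> x"
  by (simp add: ref_weight_def)

lemma ref_measure_eq_density:
  "ref_measure \<kappa> = density lborel (\<lambda>x. ennreal (ref_weight \<kappa> x * indicator (ref_supp \<kappa>) x))"
  by (cases \<kappa>) (simp_all add: ref_weight_def ref_supp_def)

lemma sets_ref_measure [simp, measurable_cong]: "sets (ref_measure \<kappa>) = sets borel"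
  by (simp add: ref_measure_eq_density)

lemma space_ref_measure [simp]: "space (ref_measure \<kappa>) = UNIV"
  by (simp add: ref_measure_eq_density)

lemma norm_square_eq_sum: "(norm x)\<^sup>2 = (\<Sum>i\<in>UNIV. (x $ i)\<^sup>2)" for x :: "real ^ 'n::finite"
  by (simp add: norm_vec_def L2_set_def sum_nonneg)

lemma ref_weight_bound:
  "\<exists>C\<ge>0. \<forall>x\<in>ref_supp \<kappa>. ref_weight \<kappa> (x :: real ^ 'n::finite) \<le> C * exp (- l1_norm x)"
proof (intro exI conjI ballI)
  \<comment> \<open>The factor exp (n/2) comes from |x_i| \<le> 1/2 + x_i^2/2 in the Gaussian
    case.\<close>
  let ?C = "(2 * pi) powr (- real CARD('n) / 2) * exp (real CARD('n) / 2)"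
  show "0 \<le> ?C" by simp
  fix x :: "real ^ 'n" assume x: "x \<in> ref_supp \<kappa>"
  have "- (case \<kappa> of Gaussian \<Rightarrow> (norm x)\<^sup>2 / 2 | Exponential \<Rightarrow> (\<Sum>i\<in>UNIV. x $ i)) \<le>
      real CARD('n) / 2 - l1_norm x"
  proof (cases \<kappa>)
    case Gaussian
    have "(\<Sum>i\<in>UNIV. \<bar>x $ i\<bar>) \<le> (\<Sum>i\<in>(UNIV :: 'n set). 1 / 2 + (x $ i)\<^sup>2 / 2)"
    proof (rule sum_mono)
      fix i :: 'n
      have "0 \<le> (\<bar>x $ i\<bar> - 1)\<^sup>2" by simp
      then show "\<bar>x $ i\<bar> \<le> 1 / 2 + (x $ i)\<^sup>2 / 2" by (simp add: power2_diff)
    qed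
    then show ?thesis
      using Gaussian by (simp add: l1_norm_def norm_square_eq_sum sum.distrib sum_divide_distrib)
  next
    case Exponential
    then have "l1_norm x = (\<Sum>i\<in>UNIV. x $ i)"
      using x by (simp add: l1_norm_def ref_supp_def nonneg_orthant_def)
    then show ?thesis using Exponential by simp
  qed
  then have "exp (- (case \<kappa> of Gaussian \<Rightarrow> (norm x)\<^sup>2 / 2 | Exponential \<Rightarrow> (\<Sum>i\<in>UNIV. x $ i))) \<le>
      exp (real CARD('n) / 2) * exp (- l1_norm x)"
    by (simp flip: exp_add)
  then show "ref_weight \<kappa> x \<le> ?C * exp (- l1_norm x)"
    unfolding ref_weight_def mult.assoc by (intro mult_left_mono) auto
qed

lemma integral_ref_measure:
  assumes "h \<in> borel_measurable borel"
  shows "(\<integral>x. h x \<partial>ref_measure \<kappa>) =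
    (\<integral>x. ref_weight \<kappa> x * indicator (ref_supp \<kappa>) x * h x \<partial>lborel :: real)"
  unfolding ref_measure_eq_density using assms
  by (subst integral_density) (auto simp: less_imp_le[OF ref_weight_pos])

text \<open>On the support the weight decays like exp (- l1_norm x), so spending the rate 1/2 leaves
  an integrable exponential.\<close>

lemma exp_integrable_ref_measure: "exp_integrable_measure (ref_measure \<kappa>) (1 / 2)"
proof
  obtain C where C: "0 \<le> C" "\<And>x. x \<in> ref_supp \<kappa> \<Longrightarrow> ref_weight \<kappa> (x :: real ^ 'n) \<le> C * exp (- l1_norm x)"
    using ref_weight_bound by blast
  have "integrable lborel (\<lambda>x :: real ^ 'n. C * exp (- (1 / 2 * l1_norm x)))"
    by (intro integrable_mult_right integrable_exp_l1_norm) simp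
  then have "integrable lborel (\<lambda>x :: real ^ 'n.
      (ref_weight \<kappa> x * indicator (ref_supp \<kappa>) x) *\<^sub>R exp (1 / 2 * l1_norm x))"
  proof (rule Bochner_Integration.integrable_bound)
    have "norm ((ref_weight \<kappa> x * indicator (ref_supp \<kappa>) x) *\<^sub>R exp (1 / 2 * l1_norm x)) \<le>
        norm (C * exp (- (1 / 2 * l1_norm x)))" for x :: "real ^ 'n"
    proof (cases "x \<in> ref_supp \<kappa>")
      case True
      have "ref_weight \<kappa> x * exp (1 / 2 * l1_norm x) \<le> C * exp (- l1_norm x) * exp (1 / 2 * l1_norm x)"
        by (intro mult_right_mono C True) simp
      also have "\<dots> = C * exp (- (1 / 2 * l1_norm x))"
        by (simp add: mult.assoc flip: exp_add)
      finally show ?thesis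
        using True C(1) less_imp_le[OF ref_weight_pos[of \<kappa> x]] by (simp add: abs_mult)
    qed (use C in simp)
    then show "AE x in lborel. norm ((ref_weight \<kappa> x * indicator (ref_supp \<kappa>) x) *\<^sub>R exp (1 / 2 * l1_norm x)) \<le>
        norm (C * exp (- (1 / 2 * l1_norm (x :: real ^ 'n))))" by simp
  qed measurable
  then show "integrable (ref_measure \<kappa>) (\<lambda>x :: real ^ 'n. exp (1 / 2 * l1_norm x))"
    unfolding ref_measure_eq_density
    by (subst integrable_density) (auto simp: less_imp_le[OF ref_weight_pos])
qed auto

interpretation ref: exp_integrable_measure "ref_measure \<kappa>" "1 / 2" for \<kappa>
  by (rule exp_integrable_ref_measure)

lemma AE_ref_supp: "AE x in ref_measure \<kappa>. x \<in> ref_supp \<kappa>"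
  unfolding ref_measure_eq_density by (subst AE_density) (auto intro!: AE_I2 split: split_indicator)

lemma exp_integrable_density:
  assumes w: "\<And>x. 0 \<le> rpoly_eval w x"
  shows "exp_integrable_measure (density (ref_measure \<kappa>) (\<lambda>x. ennreal (rpoly_eval w x))) (1 / 4)"
proof
  have "integrable (ref_measure \<kappa>) (\<lambda>x. rpoly_eval w x * exp (1 / 4 * l1_norm x))"
    by (rule ref.integrable_rpoly_exp_bound[of _ w]) (auto simp: abs_mult)
  then show "integrable (density (ref_measure \<kappa>) (\<lambda>x. ennreal (rpoly_eval w x))) (\<lambda>x. exp (1 / 4 * l1_norm x))"
    using w by (subst integrable_density) auto
qed auto

lemma integrable_indicator_mult_ref:
  assumes [measurable]: "A \<in> sets borel"
  shows "integrable (ref_measure \<kappa>) (\<lambda>x. rpoly_eval p x * indicator A x)"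
  by (rule ref.integrable_rpoly_bound[of _ p]) (auto simp: indicator_def)

lemma riesz_restricted_moments:
  assumes A: "A \<in> sets borel"
  shows "riesz (\<lambda>\<alpha>. \<integral>x. monom_eval \<alpha> x * indicator A x \<partial>ref_measure \<kappa>) p =
    (\<integral>x. rpoly_eval p x * indicator A x \<partial>ref_measure \<kappa>)"
proof -
  have int: "integrable (ref_measure \<kappa>) (\<lambda>x. c * (monom_eval \<alpha> x * indicator A x))" for c \<alpha>
    using integrable_indicator_mult_ref[OF A, of \<kappa> "rmonom \<alpha>"] by simp
  show ?thesis
    unfolding riesz_def rpoly_eval_def sum_distrib_right mult.assoc
    using int by (subst Bochner_Integration.integral_sum) auto
qed

lemma riesz_moments: "riesz (moments \<kappa>) p = (\<integral>x. rpoly_eval p x \<partial>ref_measure \<kappa>)"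
  using riesz_restricted_moments[of UNIV \<kappa> p] by (simp add: moments_def[abs_def])

section \<open>Feasibility of the restricted moments\<close>

text \<open>Minus the i-th partial derivative of the logarithm of \<open>ref_weight\<close>; it lets
  both cases share one Stokes identity.\<close>

definition log_drift :: "measure_kind \<Rightarrow> 'n::finite \<Rightarrow> 'n rpoly" where
  "log_drift \<kappa> i = (case \<kappa> of Gaussian \<Rightarrow> rvar i | Exponential \<Rightarrow> 1)"

lemma stokes_poly_eq:
  "stokes_poly \<kappa> f i \<alpha> = partial_deriv i (rmonom \<alpha> * f) - rmonom \<alpha> * f * log_drift \<kappa> i"
  by (cases \<kappa>) (simp_all add: log_drift_def)

lemma has_derivative_ref_weight_axis:
  fixes x :: "real ^ 'n::finite"
  shows "((\<lambda>t. ref_weight \<kappa> (x + t *\<^sub>R axis i 1)) has_real_derivative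
    - rpoly_eval (log_drift \<kappa> i) (x + t *\<^sub>R axis i 1) * ref_weight \<kappa> (x + t *\<^sub>R axis i 1)) (at t)"
proof -
  have comp: "((\<lambda>t. (x + t *\<^sub>R axis i 1) $ j) has_real_derivative (if j = i then 1 else 0)) (at t)" for j t
    by (cases "j = i") (auto simp: axis_def intro!: derivative_eq_intros)
  have exp_der: "((\<lambda>t. c * exp (- \<phi> t)) has_real_derivative - D * (c * exp (- \<phi> t))) (at t)"
    if "(\<phi> has_real_derivative D) (at t)" for \<phi> :: "real \<Rightarrow> real" and c D
    using that by (auto intro!: derivative_eq_intros)
  show ?thesis
  proof (cases \<kappa>)
    case Gaussian
    have "((\<lambda>t. \<Sum>j\<in>UNIV. ((x + t *\<^sub>R axis i 1) $ j)\<^sup>2) has_real_derivative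
        (\<Sum>j\<in>UNIV. 2 * (x + t *\<^sub>R axis i 1) $ j * (if j = i then 1 else 0))) (at t)"
      by (intro DERIV_sum) (rule derivative_eq_intros comp refl | simp)+
    moreover have "(\<Sum>j\<in>UNIV. 2 * (x + t *\<^sub>R axis i 1) $ j * (if j = i then 1 else 0)) = 2 * (x + t *\<^sub>R axis i 1) $ i"
      by (simp add: if_distrib[of "(*) _"] cong: if_cong)
    ultimately have "((\<lambda>t. (norm (x + t *\<^sub>R axis i 1))\<^sup>2) has_real_derivative 2 * (x + t *\<^sub>R axis i 1) $ i) (at t)"
      unfolding norm_square_eq_sum by metis
    then have "((\<lambda>t. (norm (x + t *\<^sub>R axis i 1))\<^sup>2 / 2) has_real_derivative (x + t *\<^sub>R axis i 1) $ i) (at t)"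
      by (auto intro: DERIV_cong[OF DERIV_cdivide])
    from exp_der[OF this] show ?thesis
      unfolding ref_weight_def log_drift_def Gaussian measure_kind.case rpoly_eval_rvar .
  next
    case Exponential
    have "((\<lambda>t. \<Sum>j\<in>UNIV. (x + t *\<^sub>R axis i 1) $ j) has_real_derivative (\<Sum>j\<in>UNIV. if j = i then 1 else 0)) (at t)"
      by (intro DERIV_sum comp)
    then have "((\<lambda>t. \<Sum>j\<in>UNIV. (x + t *\<^sub>R axis i 1) $ j) has_real_derivative 1) (at t)"
      by simp
    from exp_der[OF this] show ?thesis
      unfolding ref_weight_def log_drift_def Exponential measure_kind.case rpoly_eval_one .
  qed
qed

lemma rpoly_weight_bound:
  fixes p :: "'n::finite rpoly"
  shows "\<exists>C\<ge>0. \<forall>x\<in>ref_supp \<kappa>. \<bar>rpoly_eval p x * ref_weight \<kappa> x\<bar> \<le> C * exp (- (1 / 2 * l1_norm x))"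
proof -
  obtain C where C: "0 \<le> C" "\<And>x. x \<in> ref_supp \<kappa> \<Longrightarrow> ref_weight \<kappa> (x :: real ^ 'n) \<le> C * exp (- l1_norm x)"
    using ref_weight_bound by blast
  obtain C' where C': "0 \<le> C'" "\<And>x. \<bar>rpoly_eval p x\<bar> \<le> C' * exp (1 / 2 * l1_norm x)"
    using rpoly_eval_exp_bound[of "1 / 2" p] by auto
  have "\<bar>rpoly_eval p x * ref_weight \<kappa> x\<bar> \<le> (C' * C) * exp (- (1 / 2 * l1_norm x))"
    if "x \<in> ref_supp \<kappa>" for x
  proof -
    have "\<bar>rpoly_eval p x * ref_weight \<kappa> x\<bar> \<le> (C' * exp (1 / 2 * l1_norm x)) * (C * exp (- l1_norm x))"
      unfolding abs_mult using C' C(2)[OF that] less_imp_le[OF ref_weight_pos[of \<kappa> x]]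
      by (intro mult_mono) auto
    also have "\<dots> = (C' * C) * (exp (1 / 2 * l1_norm x) * exp (- l1_norm x))" by (simp only: mult_ac)
    also have "\<dots> = (C' * C) * exp (- (1 / 2 * l1_norm x))" by (simp flip: exp_add)
    finally show ?thesis .
  qed
  then show ?thesis using C(1) C'(1) by (intro exI[of _ "C' * C"]) auto
qed

text \<open>Because of this, one integrable function of x dominates the derivative on the whole
  segment of length one around x.\<close>

lemma l1_norm_add_axis_ge: "\<bar>t\<bar> \<le> 1 \<Longrightarrow> l1_norm x - 1 \<le> l1_norm (x + t *\<^sub>R axis i 1)"
proof -
  assume t: "\<bar>t\<bar> \<le> 1"
  have "l1_norm x = (\<Sum>j\<in>UNIV. \<bar>(x + t *\<^sub>R axis i 1) $ j - (if j = i then t else 0)\<bar>)"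
    unfolding l1_norm_def by (intro sum.cong) (auto simp: axis_def)
  also have "\<dots> \<le> (\<Sum>j\<in>UNIV. \<bar>(x + t *\<^sub>R axis i 1) $ j\<bar> + (if j = i then \<bar>t\<bar> else 0))"
    by (intro sum_mono) (auto intro: order_trans[OF abs_triangle_ineq4])
  also have "\<dots> = l1_norm (x + t *\<^sub>R axis i 1) + \<bar>t\<bar>"
    by (simp add: l1_norm_def sum.distrib)
  finally show ?thesis using t by simp
qed

text \<open>Multiplied by the weight, the integrand is the i-th partial derivative of q times the
  weight, a function that vanishes on the frontier with q.\<close>

lemma stokes_identity:
  fixes q :: "'n::finite rpoly"
  assumes K: "closed K" "K \<subseteq> ref_supp \<kappa>" "frontier K \<in> null_sets lborel"
    and q: "\<And>x. x \<in> frontier K \<Longrightarrow> rpoly_eval q x = 0"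
  shows "(\<integral>x. rpoly_eval (partial_deriv i q - q * log_drift \<kappa> i) x * indicator K x \<partial>ref_measure \<kappa>) = 0"
proof -
  let ?p = "partial_deriv i q - q * log_drift \<kappa> i"
  let ?h = "\<lambda>x. rpoly_eval q x * ref_weight \<kappa> x"
  let ?h' = "\<lambda>x. rpoly_eval ?p x * ref_weight \<kappa> x"
  have [measurable]: "K \<in> sets borel" using K by simp
  obtain C where C: "0 \<le> C" "\<And>x. x \<in> ref_supp \<kappa> \<Longrightarrow> \<bar>?h' x\<bar> \<le> C * exp (- (1 / 2 * l1_norm x))"
    using rpoly_weight_bound by blast
  obtain C' where C': "0 \<le> C'" "\<And>x. x \<in> ref_supp \<kappa> \<Longrightarrow> \<bar>?h x\<bar> \<le> C' * exp (- (1 / 2 * l1_norm x))"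
    using rpoly_weight_bound by blast
  have int: "integrable lborel (\<lambda>x :: real ^ 'n. k * exp (- (1 / 2 * l1_norm x)))" for k
    by (intro integrable_mult_right integrable_exp_l1_norm) simp
  have "(\<integral>x. indicator K x * ?h' x \<partial>lborel) = 0"
  proof (rule integral_directional_derivative_eq_0[where e = "axis i 1" and h = ?h
        \<comment> \<open>The factor exp (1/2) pays for a shift of at most 1 at rate 1/2.\<close>
        and W = "\<lambda>x. (C * exp (1 / 2)) * exp (- (1 / 2 * l1_norm x))"])
    fix x :: "real ^ 'n" and t :: real
    show "((\<lambda>t. ?h (x + t *\<^sub>R axis i 1)) has_real_derivative ?h' (x + t *\<^sub>R axis i 1)) (at t)"
      by (rule DERIV_cong[OF DERIV_mult[OF has_derivative_rpoly_eval_axis has_derivative_ref_weight_axis]])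
        (simp add: algebra_simps)
    assume t: "\<bar>t\<bar> \<le> 1" and xt: "x + t *\<^sub>R axis i 1 \<in> K"
    have "\<bar>?h' (x + t *\<^sub>R axis i 1)\<bar> \<le> C * exp (- (1 / 2 * l1_norm (x + t *\<^sub>R axis i 1)))"
      using C(2) xt K(2) by blast
    also have "\<dots> \<le> C * exp (1 / 2 + - (1 / 2 * l1_norm x))"
      using l1_norm_add_axis_ge[OF t, of x i] C(1) by (intro mult_left_mono) auto
    finally show "\<bar>?h' (x + t *\<^sub>R axis i 1)\<bar> \<le> (C * exp (1 / 2)) * exp (- (1 / 2 * l1_norm x))"
      by (simp only: exp_add mult.assoc)
  next
    show "integrable lborel (\<lambda>x. indicator K x * ?h x)"
    proof (rule Bochner_Integration.integrable_bound[OF int[of C']])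
      have "norm (indicator K x * ?h x) \<le> norm (C' * exp (- (1 / 2 * l1_norm x)))" for x
        using C'(2)[of x] C'(1) K(2) by (auto simp: indicator_def)
      then show "AE x in lborel. norm (indicator K x * ?h x) \<le> norm (C' * exp (- (1 / 2 * l1_norm x)))"
        by simp
    qed measurable
  qed (use K C q int in auto)
  moreover have "ref_weight \<kappa> x * indicator (ref_supp \<kappa>) x * (rpoly_eval ?p x * indicator K x) =
      indicator K x * ?h' x" for x
    using K(2) by (auto simp: indicator_def)
  ultimately show ?thesis
    by (subst integral_ref_measure, measurable) (simp only:)
qed

lemma closed_semialg: "closed (semialg m g)"
proof -
  have "semialg m g = (\<Inter>j\<in>{1..m}. {x. 0 \<le> rpoly_eval (g j) x})"
    by (auto simp: semialg_def)
  then show ?thesis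
    by (auto intro!: closed_INT closed_Collect_le continuous_intros)
qed

lemma stokes_feasible_restricted_moments:
  fixes g :: "nat \<Rightarrow> 'n::finite rpoly" and f :: "'n rpoly"
  assumes sub: "semialg m g \<subseteq> ref_supp \<kappa>" and f: "f \<noteq> 0"
    and van: "\<And>x. x \<in> frontier (semialg m g) \<Longrightarrow> rpoly_eval f x = 0"
  shows "\<exists>u v. stokes_feasible \<kappa> m g f d u v \<and> u 0 = measure (ref_measure \<kappa>) (semialg m g)"
proof -
  define K where "K = semialg m g"
  have K: "closed K" by (simp add: K_def closed_semialg)
  then have meas [measurable]: "K \<in> sets borel" "- K \<in> sets borel" by auto
  have "frontier K \<subseteq> {x. rpoly_eval f x = 0}" using van by (auto simp: K_def)
  then have null: "frontier K \<in> null_sets lborel"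
    using null_sets_subset[OF rpoly_zero_set_null[OF f]] K by simp
  define m_on :: "(real ^ 'n) set \<Rightarrow> nat ^ 'n \<Rightarrow> real"
    where "m_on A \<alpha> = (\<integral>x. monom_eval \<alpha> x * indicator A x \<partial>ref_measure \<kappa>)" for A \<alpha>
  have riesz_m: "riesz (m_on A) p = (\<integral>x. rpoly_eval p x * indicator A x \<partial>ref_measure \<kappa>)"
    if "A \<in> sets borel" for A p
    unfolding m_on_def[abs_def] using that by (rule riesz_restricted_moments)
  have psd: "psd_on (exps_upto k) (localizing_matrix h (m_on A))"
    if A: "A \<in> sets borel" and h: "\<And>x. x \<in> A \<Longrightarrow> 0 \<le> rpoly_eval h x" for k h A
  proof (rule psd_on_localizing)
    fix p :: "'n rpoly"
    have "0 \<le> rpoly_eval (p * (p * h)) x * indicator A x" for x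
      using h[of x] by (auto simp: indicator_def simp flip: mult.assoc)
    then show "0 \<le> riesz (m_on A) (p * (p * h))"
      by (simp only: riesz_m[OF A]) (rule Bochner_Integration.integral_nonneg)
  qed
  have "m_on K \<alpha> + m_on (- K) \<alpha> = moments \<kappa> \<alpha>" for \<alpha>
  proof -
    have "m_on K \<alpha> + m_on (- K) \<alpha> =
        (\<integral>x. monom_eval \<alpha> x * indicator K x + monom_eval \<alpha> x * indicator (- K) x \<partial>ref_measure \<kappa>)"
      unfolding m_on_def
      using integrable_indicator_mult_ref[of _ \<kappa> "rmonom \<alpha>"] meas
      by (subst Bochner_Integration.integral_add) auto
    also have "\<dots> = moments \<kappa> \<alpha>"
      unfolding moments_def by (intro Bochner_Integration.integral_cong) (auto simp: indicator_def)
    finally show ?thesis .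
  qed
  \<comment> \<open>The product of the monomial and f vanishes on the frontier together with
    f.\<close>
  moreover have "riesz (m_on K) (stokes_poly \<kappa> f i \<alpha>) = 0" for i \<alpha>
    unfolding riesz_m[OF meas(1)] stokes_poly_eq
    using van sub by (intro stokes_identity K null) (auto simp: K_def)
  moreover have "psd_on (exps_upto (int d)) (moment_matrix (m_on K))"
      "psd_on (exps_upto (int d)) (moment_matrix (m_on (- K)))"
    unfolding moment_matrix_eq_localizing by (intro psd meas; simp)+
  moreover have "psd_on (exps_upto k) (localizing_matrix (g j) (m_on K))" if "j \<in> {1..m}" for j k
    using that by (intro psd meas) (auto simp: K_def semialg_def)
  ultimately have "stokes_feasible \<kappa> m g f d (m_on K) (m_on (- K))"
    unfolding stokes_feasible_def by blast
  moreover have "m_on K 0 = measure (ref_measure \<kappa>) K"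
    by (simp add: m_on_def)
  ultimately show ?thesis unfolding K_def by blast
qed

section \<open>Convergence of the upper bounds\<close>

lemma psd_on_subset:
  assumes A: "psd_on I A" and J: "J \<subseteq> I" "finite I"
  shows "psd_on J A"
  unfolding psd_on_def
proof (intro conjI ballI allI)
  fix c :: "'a \<Rightarrow> real"
  let ?c = "\<lambda>a. if a \<in> J then c a else 0"
  have "0 \<le> (\<Sum>a\<in>I. \<Sum>b\<in>I. ?c a * A a b * ?c b)"
    using A unfolding psd_on_def by (elim conjE allE[of _ ?c])
  also have "\<dots> = (\<Sum>a\<in>J. \<Sum>b\<in>J. c a * A a b * c b)"
    using J by (intro sum.mono_neutral_cong_right ballI) (auto intro!: sum.neutral sum.mono_neutral_cong_right)
  finally show "0 \<le> (\<Sum>a\<in>J. \<Sum>b\<in>J. c a * A a b * c b)" .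
qed (use A J in \<open>auto simp: psd_on_def\<close>)

text \<open>Sequences are total functions, so truncation changes nothing and only the index sets
  shrink.\<close>

lemma stokes_feasible_mono:
  assumes f: "stokes_feasible \<kappa> m g f d' u v" and d: "d \<le> d'"
  shows "stokes_feasible \<kappa> m g f d u v"
proof -
  have "stokes_deg \<kappa> f d \<le> stokes_deg \<kappa> f d'"
    using d by (cases \<kappa>) auto
  then have "exps_upto (stokes_deg \<kappa> f d) \<subseteq> exps_upto (stokes_deg \<kappa> f d')" by (rule exps_upto_mono)
  moreover have "exps_upto (2 * int d) \<subseteq> (exps_upto (2 * int d') :: (nat ^ 'a) set)"
    "exps_upto (int d) \<subseteq> (exps_upto (int d') :: (nat ^ 'a) set)"
    "exps_upto (int d - k) \<subseteq> (exps_upto (int d' - k) :: (nat ^ 'a) set)" for k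
    using d by (auto intro!: exps_upto_mono)
  ultimately show ?thesis
    using f unfolding stokes_feasible_def
    by (meson finite_exps_upto psd_on_subset subsetD)
qed

text \<open>The gap between the two sides is \<open>riesz v (p * p)\<close>. Degree d for p keeps
  the square within degree 2d, where u + v equals the moments.\<close>

lemma stokes_feasible_riesz_square_le:
  assumes f: "stokes_feasible \<kappa> m g f d u v" and p: "Poly_Mapping.keys p \<subseteq> exps_upto (int d)"
  shows "riesz u (p * p) \<le> (\<integral>x. (rpoly_eval p x)\<^sup>2 \<partial>ref_measure \<kappa>)"
proof -
  have k: "Poly_Mapping.keys (p * p) \<subseteq> exps_upto (2 * int d)"
    using keys_mult_exps_upto[OF p p] by simp
  have "0 \<le> riesz v (p * p)"
    using f p by (intro riesz_square_nonneg) (auto simp: stokes_feasible_def)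
  moreover have "riesz u (p * p) + riesz v (p * p) = riesz (moments \<kappa>) (p * p)"
    unfolding riesz_add_functional[symmetric]
    unfolding riesz_def using f k by (intro sum.cong) (auto simp: stokes_feasible_def)
  ultimately show ?thesis
    by (simp add: riesz_moments power2_eq_square)
qed

lemma stokes_feasible_u_0_le:
  fixes g :: "nat \<Rightarrow> 'n::finite rpoly"
  assumes "stokes_feasible \<kappa> m g f d u v"
  shows "u 0 \<le> measure (ref_measure \<kappa> :: (real ^ 'n) measure) UNIV"
  using stokes_feasible_riesz_square_le[OF assms, of 1]
  by (simp add: riesz_one exps_upto_def exp_deg_def)

text \<open>Cauchy-Schwarz in linearised form: expand the nonnegative value of \<open>u\<close> on
  the square of t - r and divide by 2t. The parameter t is chosen later to balance the two
  terms.\<close>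

lemma stokes_feasible_riesz_le:
  fixes g :: "nat \<Rightarrow> 'n::finite rpoly"
  assumes f: "stokes_feasible \<kappa> m g f d u v" and r: "Poly_Mapping.keys r \<subseteq> exps_upto (int d)"
    and t: "0 < t"
  shows "riesz u r \<le> t / 2 * measure (ref_measure \<kappa> :: (real ^ 'n) measure) UNIV +
    (\<integral>x. (rpoly_eval r x)\<^sup>2 \<partial>ref_measure \<kappa>) / (2 * t)"
proof -
  let ?c = "Poly_Mapping.single 0 t :: 'n rpoly"
  have "Poly_Mapping.keys ?c \<subseteq> exps_upto (int d)"
    by (auto simp: exps_upto_def exp_deg_def split: if_splits)
  then have "Poly_Mapping.keys (?c - r) \<subseteq> exps_upto (int d)"
    using keys_diff[of ?c r] r by blast
  then have "0 \<le> riesz u ((?c - r) * (?c - r))"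
    using f by (intro riesz_square_nonneg) (auto simp: stokes_feasible_def)
  also have "(?c - r) * (?c - r) = ?c * ?c - (?c * r + ?c * r) + r * r"
    by (simp add: algebra_simps)
  also have "riesz u \<dots> = t\<^sup>2 * u 0 - 2 * t * riesz u r + riesz u (r * r)"
    by (simp only: riesz_add riesz_diff riesz_single_mult riesz_single) (simp add: power2_eq_square)
  finally have "2 * t * riesz u r \<le> t\<^sup>2 * u 0 + riesz u (r * r)" by simp
  also have "\<dots> \<le> t\<^sup>2 * measure (ref_measure \<kappa> :: (real ^ 'n) measure) UNIV +
      (\<integral>x. (rpoly_eval r x)\<^sup>2 \<partial>ref_measure \<kappa>)"
    by (intro add_mono mult_left_mono stokes_feasible_u_0_le[OF f] stokes_feasible_riesz_square_le[OF f r]) simp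
  finally show ?thesis
    using t by (simp add: field_simps power2_eq_square)
qed

definition violation :: "nat \<Rightarrow> (nat \<Rightarrow> 'n::finite rpoly) \<Rightarrow> real ^ 'n \<Rightarrow> real" where
  "violation m g x = (\<Sum>j=1..m. (max 0 (- rpoly_eval (g j) x))\<^sup>2)"

lemma violation_nonneg: "0 \<le> violation m g x"
  by (simp add: violation_def sum_nonneg)

lemma violation_eq_0_iff: "violation m g x = 0 \<longleftrightarrow> x \<in> semialg m g"
proof -
  have "violation m g x = 0 \<longleftrightarrow> (\<forall>j\<in>{1..m}. (max 0 (- rpoly_eval (g j) x))\<^sup>2 = 0)"
    unfolding violation_def by (rule sum_nonneg_eq_0_iff) auto
  then show ?thesis by (auto simp: semialg_def max_def split: if_splits)
qed

lemma continuous_violation [continuous_intros]: "continuous_on S (violation m g)"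
  unfolding violation_def by (intro continuous_intros)

text \<open>The integrands decrease pointwise to the indicator of the set, because
  \<open>violation\<close> vanishes exactly there.\<close>

lemma integral_penalty_tendsto:
  "(\<lambda>N. \<integral>x. 1 / (1 + real N * violation m g x) \<partial>ref_measure \<kappa>) \<longlonglongrightarrow>
    measure (ref_measure \<kappa>) (semialg m g)"
proof -
  have [measurable]: "violation m g \<in> borel_measurable borel"
    by (intro borel_measurable_continuous_onI continuous_intros)
  have [measurable]: "semialg m g \<in> sets borel" by (simp add: closed_semialg)
  have "(\<lambda>N. \<integral>x. 1 / (1 + real N * violation m g x) \<partial>ref_measure \<kappa>) \<longlonglongrightarrow>
      (\<integral>x. indicator (semialg m g) x \<partial>ref_measure \<kappa>)"
  proof (rule integral_dominated_convergence[of _ _ _ "\<lambda>x. 1"])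
    show "AE x in ref_measure \<kappa>. (\<lambda>N. 1 / (1 + real N * violation m g x)) \<longlonglongrightarrow> indicator (semialg m g) x"
    proof (rule AE_I2)
      fix x
      show "(\<lambda>N. 1 / (1 + real N * violation m g x)) \<longlonglongrightarrow> indicator (semialg m g) x"
      proof (cases "x \<in> semialg m g")
        case True
        then show ?thesis by (simp flip: violation_eq_0_iff)
      next
        case False
        then have v: "0 < violation m g x"
          using violation_nonneg[of m g x] violation_eq_0_iff[of m g x] by linarith
        have "filterlim (\<lambda>N. 1 + real N * violation m g x) at_infinity sequentially"
          using v by (intro filterlim_at_top_imp_at_infinity filterlim_tendsto_add_at_top[OF tendsto_const]
              filterlim_at_top_mult_tendsto_pos[OF tendsto_const _ filterlim_real_sequentially])
        then have "(\<lambda>N. 1 / (1 + real N * violation m g x)) \<longlonglongrightarrow> 0"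
          by (rule tendsto_divide_0[OF tendsto_const])
        then show ?thesis using False by simp
      qed
    qed
    show "AE x in ref_measure \<kappa>. norm (1 / (1 + real N * violation m g x)) \<le> 1" for N
      using violation_nonneg[of m g] by (intro AE_I2) (simp add: divide_le_eq_1 abs_of_pos add_pos_nonneg)
  qed auto
  then show ?thesis by simp
qed

text \<open>
  With \<open>\<phi>\<^sub>j = max 0 (- g\<^sub>j)\<close> and \<open>\<Phi> = \<Sum> \<phi>\<^sub>j\<^sup>2\<close>, the bounded continuous functions
  \<open>F\<^sub>0 = sqrt (1 / (1 + N \<Phi>))\<close> and \<open>F\<^sub>j = sqrt (N \<phi>\<^sub>j / (1 + N \<Phi>))\<close> satisfy
  \<open>1 = F\<^sub>0\<^sup>2 - \<Sum> g\<^sub>j F\<^sub>j\<^sup>2\<close> exactly. Replacing them by polynomials gives a certificate for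
  \<open>u\<^sub>0 \<le> \<integral> F\<^sub>0\<^sup>2\<close> up to an error \<open>r\<close> that is small in \<open>L\<^sup>2\<close>, and the functional of a feasible
  \<open>u\<close> is bounded with respect to the \<open>L\<^sup>2\<close> norm.
\<close>

lemma stokes_feasible_eventually_le:
  fixes g :: "nat \<Rightarrow> 'n::finite rpoly"
  assumes \<epsilon>: "0 < \<epsilon>"
  shows "\<exists>D. \<forall>d\<ge>D. \<forall>f u v. stokes_feasible \<kappa> m g f d u v \<longrightarrow>
    u 0 \<le> measure (ref_measure \<kappa>) (semialg m g) + \<epsilon>"
proof -
  let ?\<mu> = "ref_measure \<kappa> :: (real ^ 'n) measure"
  let ?\<Phi> = "violation m g"
  define M where "M = measure ?\<mu> UNIV"
  have M: "0 \<le> M" by (simp add: M_def)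
  have "\<forall>\<^sub>F N in sequentially. (\<integral>x. 1 / (1 + real N * ?\<Phi> x) \<partial>?\<mu>) < measure ?\<mu> (semialg m g) + \<epsilon> / 3"
    using integral_penalty_tendsto \<epsilon> by (intro order_tendstoD(2)) auto
  then have "\<forall>\<^sub>F N in sequentially. (\<integral>x. 1 / (1 + real N * ?\<Phi> x) \<partial>?\<mu>) < measure ?\<mu> (semialg m g) + \<epsilon> / 3 \<and> 1 \<le> N"
    using eventually_ge_at_top[of 1] by (rule eventually_conj)
  then obtain N where N: "(\<integral>x. 1 / (1 + real N * ?\<Phi> x) \<partial>?\<mu>) < measure ?\<mu> (semialg m g) + \<epsilon> / 3" "1 \<le> N"
    unfolding eventually_sequentially by blast
  \<comment> \<open>Index 0 carries the pure square as if it belonged to the constraint -1, so that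
    the identity becomes 1 + \<Sum> G_j F_j^2 = 0 over one index set.\<close>
  define S where "S = insert 0 {1..m}"
  have S: "finite S" "card S = m + 1" by (auto simp: S_def)
  define G where "G j = (if j = 0 then - 1 else g j)" for j
  define num where "num j x = (if j = 0 then 1 else real N * max 0 (- rpoly_eval (g j) x))" for j x
  define F where "F j x = sqrt (num j x / (1 + real N * ?\<Phi> x))" for j x
  have den: "0 < 1 + real N * ?\<Phi> x" for x
    using violation_nonneg[of m g x] by (simp add: add_pos_nonneg)
  have num_nonneg: "0 \<le> num j x" for j x by (simp add: num_def)
  have F_sq: "(F j x)\<^sup>2 = num j x / (1 + real N * ?\<Phi> x)" for j x
    using num_nonneg[of j x] less_imp_le[OF den[of x]] by (simp add: F_def)
  have F_cont: "continuous_on UNIV (F j)" for j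
  proof -
    have "continuous_on UNIV (num j)" unfolding num_def by (cases "j = 0") (auto intro!: continuous_intros)
    then show ?thesis unfolding F_def
      using den by (intro continuous_intros) (auto simp: less_imp_neq[symmetric])
  qed
  \<comment> \<open>For a = max 0 (-g_j) one has a \<le> 1 + a^2 \<le> 1 + N \<Phi>, so F_j^2 \<le>
    N; passing to N^2 avoids a square root.\<close>
  have F_bound: "\<bar>F j x\<bar> \<le> real N" if "j \<in> S" for j x
  proof -
    have "num j x \<le> real N * (1 + real N * ?\<Phi> x)"
    proof (cases "j = 0")
      case True
      have "1 * 1 \<le> real N * (1 + real N * ?\<Phi> x)"
        using N(2) violation_nonneg[of m g x] by (intro mult_mono) auto
      then show ?thesis using True by (simp add: num_def)
    next
      case False
      define a where "a = max 0 (- rpoly_eval (g j) x)"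
      have "a\<^sup>2 \<le> ?\<Phi> x"
        unfolding violation_def a_def using that False
        by (intro member_le_sum[of j "{1..m}" "\<lambda>j. (max 0 (- rpoly_eval (g j) x))\<^sup>2"]) (auto simp: S_def)
      moreover have "a \<le> 1 + a\<^sup>2"
      proof -
        have "0 \<le> (a - 1)\<^sup>2" by simp
        then have "2 * a \<le> 1 + a\<^sup>2" by (simp add: power2_diff)
        moreover have "0 \<le> a" by (simp add: a_def)
        ultimately show ?thesis by linarith
      qed
      moreover have "?\<Phi> x \<le> real N * ?\<Phi> x"
        using N(2) violation_nonneg[of m g x] mult_right_mono[of 1 "real N" "?\<Phi> x"] by simp
      ultimately have "a \<le> 1 + real N * ?\<Phi> x" by linarith
      then show ?thesis using False by (simp add: num_def a_def mult_left_mono)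
    qed
    then have "(F j x)\<^sup>2 \<le> real N" using den[of x] by (simp add: F_sq pos_divide_le_eq)
    also have "\<dots> \<le> (real N)\<^sup>2" using N(2) by (simp add: power2_eq_square)
    finally show ?thesis by (simp add: abs_le_square_iff[symmetric])
  qed
  have identity: "1 + (\<Sum>j\<in>S. rpoly_eval (G j) x * (F j x)\<^sup>2) = 0" for x
  proof -
    have sq: "rpoly_eval (g j) x * max 0 (- rpoly_eval (g j) x) = - (max 0 (- rpoly_eval (g j) x))\<^sup>2" for j
      by (simp add: max_def power2_eq_square)
    have "rpoly_eval (g j) x * (real N * max 0 (- rpoly_eval (g j) x)) =
        - (real N * (max 0 (- rpoly_eval (g j) x))\<^sup>2)" for j
      using arg_cong[OF sq[of j], of "(*) (real N)"] by (simp only: mult.left_commute mult_minus_right)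
    then have "(\<Sum>j=1..m. rpoly_eval (G j) x * (F j x)\<^sup>2) =
        (\<Sum>j=1..m. - (real N / (1 + real N * ?\<Phi> x) * (max 0 (- rpoly_eval (g j) x))\<^sup>2))"
      by (intro sum.cong) (auto simp: G_def F_sq num_def)
    also have "\<dots> = - (real N / (1 + real N * ?\<Phi> x) * ?\<Phi> x)"
      unfolding violation_def sum_negf sum_distrib_left ..
    finally show ?thesis
      using den[of x] by (simp add: S_def G_def F_sq num_def field_simps)
  qed
  \<comment> \<open>One weight for all indices: the squared error of each term G_j e_j in L^2(\<mu>)
    is at most that of e_j in L^2(\<nu>).\<close>
  define w where "w = (\<Sum>j\<in>S. G j * G j)"
  have w: "rpoly_eval w x = (\<Sum>j\<in>S. (rpoly_eval (G j) x)\<^sup>2)" for x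
    by (simp add: w_def power2_eq_square)
  have w_nonneg: "0 \<le> rpoly_eval w x" for x by (simp add: w sum_nonneg)
  define \<nu> where "\<nu> = density ?\<mu> (\<lambda>x. ennreal (rpoly_eval w x))"
  interpret \<nu>: exp_integrable_measure \<nu> "1 / 4"
    unfolding \<nu>_def by (rule exp_integrable_density[OF w_nonneg])
  \<comment> \<open>The budget has three thirds: the penalty integral exceeds the measure of the set
    by at most \<epsilon>/3, the terms with t M add \<epsilon>/3, and \<open>\<eta>\<close> is
    chosen so that the terms divided by 2t add \<epsilon>/3.\<close>
  define t where "t = \<epsilon> / (3 * (M + 1))"
  have t: "0 < t" using \<epsilon> M by (simp add: t_def)
  have tM: "t * M \<le> \<epsilon> / 3" using \<epsilon> M by (simp add: t_def field_simps)
  \<comment> \<open>One factor m + 1 comes from squaring a sum of m + 1 terms, the other from adding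
    up their m + 1 bounds.\<close>
  define A where "A = (real m + 1)\<^sup>2"
  have A: "1 \<le> A" by (simp add: A_def power2_eq_square algebra_simps)
  define \<eta> where "\<eta> = t * \<epsilon> / (3 * A)"
  have \<eta>: "0 < \<eta>" using t \<epsilon> A by (simp add: \<eta>_def)
  have "\<exists>q. (\<integral>x. ((rpoly_eval q x)\<^sup>2 - (F j x)\<^sup>2)\<^sup>2 \<partial>\<nu>) < \<eta>" if "j \<in> S" for j
    by (rule \<nu>.square_approximation[OF F_cont F_bound[OF that] \<eta>])
  then obtain q where q: "\<And>j. j \<in> S \<Longrightarrow> (\<integral>x. ((rpoly_eval (q j) x)\<^sup>2 - (F j x)\<^sup>2)\<^sup>2 \<partial>\<nu>) < \<eta>"
    by metis
  have [measurable]: "F j \<in> borel_measurable borel" for j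
    by (intro borel_measurable_continuous_onI F_cont)
  define e where "e j x = (rpoly_eval (q j) x)\<^sup>2 - (F j x)\<^sup>2" for j x
  have e_meas [measurable]: "e j \<in> borel_measurable borel" for j unfolding e_def by measurable
  \<comment> \<open>\<open>square_approximation\<close> bounds an integral but does not assert
    integrability, which the monotonicity of integrals needs.\<close>
  have Ge_int: "integrable ?\<mu> (\<lambda>x. (rpoly_eval (G i) x * e j x)\<^sup>2)" if "j \<in> S" for i j
  proof (rule ref.integrable_rpoly_bound[of _ "(G i)\<^sup>2 * (q j ^ 2 + Poly_Mapping.single 0 ((real N)\<^sup>2))\<^sup>2"])
    fix x
    have "(F j x)\<^sup>2 \<le> (real N)\<^sup>2"
      using F_bound[OF that, of x] by (simp add: abs_le_square_iff[symmetric])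
    then have "\<bar>e j x\<bar> \<le> (rpoly_eval (q j) x)\<^sup>2 + (real N)\<^sup>2"
      unfolding e_def using zero_le_power2[of "rpoly_eval (q j) x"] zero_le_power2[of "F j x"] by linarith
    then have "(e j x)\<^sup>2 \<le> ((rpoly_eval (q j) x)\<^sup>2 + (real N)\<^sup>2)\<^sup>2"
      using power_mono[of "\<bar>e j x\<bar>" _ 2] by simp
    then show "\<bar>(rpoly_eval (G i) x * e j x)\<^sup>2\<bar> \<le>
        \<bar>rpoly_eval ((G i)\<^sup>2 * (q j ^ 2 + Poly_Mapping.single 0 ((real N)\<^sup>2))\<^sup>2) x\<bar>"
      by (simp add: power_mult_distrib mult_left_mono)
  qed measurable
  have small: "(\<integral>x. (rpoly_eval (G j) x * e j x)\<^sup>2 \<partial>?\<mu>) \<le> \<eta>" if j: "j \<in> S" for j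
  proof -
    have wsum: "rpoly_eval w x * (e j x)\<^sup>2 = (\<Sum>i\<in>S. (rpoly_eval (G i) x * e j x)\<^sup>2)" for x
      by (simp add: w sum_distrib_right power_mult_distrib)
    note int = Ge_int[OF j]
    have "(\<integral>x. (rpoly_eval (G j) x * e j x)\<^sup>2 \<partial>?\<mu>) \<le> (\<integral>x. rpoly_eval w x * (e j x)\<^sup>2 \<partial>?\<mu>)"
    proof (rule integral_mono)
      show "integrable ?\<mu> (\<lambda>x. (rpoly_eval (G j) x * e j x)\<^sup>2)" by (rule int)
      show "integrable ?\<mu> (\<lambda>x. rpoly_eval w x * (e j x)\<^sup>2)"
        unfolding wsum by (intro Bochner_Integration.integrable_sum int)
      show "(rpoly_eval (G j) x * e j x)\<^sup>2 \<le> rpoly_eval w x * (e j x)\<^sup>2" for x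
        unfolding wsum using j S(1) by (intro member_le_sum[of j S "\<lambda>i. (rpoly_eval (G i) x * e j x)\<^sup>2"]) auto
    qed
    also have "\<dots> = (\<integral>x. (e j x)\<^sup>2 \<partial>\<nu>)"
      unfolding \<nu>_def using w_nonneg by (subst integral_density) auto
    also have "\<dots> \<le> \<eta>" using q[OF j] by (simp add: e_def)
    finally show ?thesis .
  qed
  \<comment> \<open>The identity with q_j in place of F_j; subtracting the exact identity leaves
    only the errors G_j e_j.\<close>
  define r where "r = 1 + (\<Sum>j\<in>S. q j * (q j * G j))"
  have r: "rpoly_eval r x = (\<Sum>j\<in>S. rpoly_eval (G j) x * e j x)" for x
  proof -
    have "rpoly_eval r x = 1 + (\<Sum>j\<in>S. rpoly_eval (G j) x * (rpoly_eval (q j) x)\<^sup>2)"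
      by (simp add: r_def power2_eq_square mult_ac)
    also have "\<dots> = (\<Sum>j\<in>S. rpoly_eval (G j) x * e j x)"
      using identity[of x] by (simp add: e_def right_diff_distrib sum_subtractf)
    finally show ?thesis .
  qed
  have r_small: "(\<integral>x. (rpoly_eval r x)\<^sup>2 \<partial>?\<mu>) \<le> A * \<eta>"
  proof -
    note int = Ge_int
    have "(\<integral>x. (rpoly_eval r x)\<^sup>2 \<partial>?\<mu>) \<le> (\<integral>x. (real m + 1) * (\<Sum>j\<in>S. (rpoly_eval (G j) x * e j x)\<^sup>2) \<partial>?\<mu>)"
    proof (rule integral_mono)
      show "integrable ?\<mu> (\<lambda>x. (rpoly_eval r x)\<^sup>2)"
        using ref.integrable_rpoly[of \<kappa> "r ^ 2"] by (simp add: rpoly_eval_power[abs_def])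
      show "integrable ?\<mu> (\<lambda>x. (real m + 1) * (\<Sum>j\<in>S. (rpoly_eval (G j) x * e j x)\<^sup>2))"
        by (intro integrable_mult_right Bochner_Integration.integrable_sum int)
      show "(rpoly_eval r x)\<^sup>2 \<le> (real m + 1) * (\<Sum>j\<in>S. (rpoly_eval (G j) x * e j x)\<^sup>2)" for x
        using sum_squared_le_sum_of_squares[of "\<lambda>j. rpoly_eval (G j) x * e j x" S] S
        by (simp add: r mult.commute add.commute)
    qed
    also have "\<dots> = (real m + 1) * (\<Sum>j\<in>S. \<integral>x. (rpoly_eval (G j) x * e j x)\<^sup>2 \<partial>?\<mu>)"
      using int by (simp add: Bochner_Integration.integral_sum)
    also have "\<dots> \<le> (real m + 1) * (\<Sum>j\<in>S. \<eta>)"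
      by (intro mult_left_mono sum_mono small) auto
    also have "\<dots> = A * \<eta>" using S by (simp add: A_def power2_eq_square algebra_simps)
    finally show ?thesis .
  qed
  have q0: "(\<integral>x. (rpoly_eval (q 0) x)\<^sup>2 \<partial>?\<mu>) \<le> measure ?\<mu> (semialg m g) + \<epsilon> / 3 + t / 2 * M + \<eta> / (2 * t)"
  proof -
    have "0 \<in> S" by (simp add: S_def)
    have e0: "integrable ?\<mu> (\<lambda>x. (e 0 x)\<^sup>2)" "(\<integral>x. (e 0 x)\<^sup>2 \<partial>?\<mu>) \<le> \<eta>"
      using Ge_int[OF \<open>0 \<in> S\<close>, of 0] small[OF \<open>0 \<in> S\<close>] by (simp_all add: G_def)
    have F0: "integrable ?\<mu> (\<lambda>x. (F 0 x)\<^sup>2)"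
      using power_mono[OF F_bound[OF \<open>0 \<in> S\<close>], where n = 2]
      by (intro ref.integrable_bounded[of _ "(real N)\<^sup>2"]) auto
    \<comment> \<open>The error e_0 is bounded pointwise by expanding the square of t - e_0. The
      same t as for \<open>riesz u r\<close> is used, so t M / 2 occurs twice in the end.\<close>
    have "(\<integral>x. (rpoly_eval (q 0) x)\<^sup>2 \<partial>?\<mu>) \<le> (\<integral>x. (F 0 x)\<^sup>2 + t / 2 + (e 0 x)\<^sup>2 / (2 * t) \<partial>?\<mu>)"
    proof (rule integral_mono)
      show "integrable ?\<mu> (\<lambda>x. (rpoly_eval (q 0) x)\<^sup>2)"
        using ref.integrable_rpoly[of \<kappa> "q 0 ^ 2"] by (simp add: rpoly_eval_power[abs_def])
      show "integrable ?\<mu> (\<lambda>x. (F 0 x)\<^sup>2 + t / 2 + (e 0 x)\<^sup>2 / (2 * t))"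
        using F0 e0 by simp
      fix x
      have "0 \<le> (t - e 0 x)\<^sup>2" by simp
      then have "e 0 x \<le> t / 2 + (e 0 x)\<^sup>2 / (2 * t)"
        using t by (simp add: power2_diff field_simps) (simp add: power2_eq_square)
      then show "(rpoly_eval (q 0) x)\<^sup>2 \<le> (F 0 x)\<^sup>2 + t / 2 + (e 0 x)\<^sup>2 / (2 * t)"
        by (simp add: e_def)
    qed
    also have "\<dots> = (\<integral>x. (F 0 x)\<^sup>2 \<partial>?\<mu>) + t / 2 * M + (\<integral>x. (e 0 x)\<^sup>2 \<partial>?\<mu>) / (2 * t)"
      using F0 e0(1) by (simp add: M_def)
    also have "(\<integral>x. (F 0 x)\<^sup>2 \<partial>?\<mu>) \<le> measure ?\<mu> (semialg m g) + \<epsilon> / 3"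
      using N(1) by (simp add: F_sq num_def)
    also have "(\<integral>x. (e 0 x)\<^sup>2 \<partial>?\<mu>) / (2 * t) \<le> \<eta> / (2 * t)"
      using e0(2) t by (simp add: divide_right_mono)
    finally show ?thesis by simp
  qed
  obtain kr where kr: "Poly_Mapping.keys r \<subseteq> exps_upto (int kr)"
    using rpoly_degree_bound_exists by blast
  have "\<forall>j. \<exists>k. Poly_Mapping.keys (q j) \<subseteq> exps_upto (int k)"
    using rpoly_degree_bound_exists by blast
  then obtain k where k: "\<And>j. Poly_Mapping.keys (q j) \<subseteq> exps_upto (int (k j))"
    by metis
  \<comment> \<open>From this order on, r has degree at most d and each q_j fits the index set of
    its localizing matrix, which has lost \<open>half_deg (g j)\<close>.\<close>
  define D where "D = kr + (\<Sum>j\<in>S. k j + half_deg (g j))"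
  show ?thesis
  proof (intro exI[of _ D] allI impI)
    fix d f u v assume d: "D \<le> d" and fs: "stokes_feasible \<kappa> m g f d u v"
    have kd: "k j + half_deg (g j) \<le> d" if "j \<in> S" for j
      using member_le_sum[of j S "\<lambda>j. k j + half_deg (g j)"] that S d by (simp add: D_def)
    have r_deg: "Poly_Mapping.keys r \<subseteq> exps_upto (int d)"
      using kr exps_upto_mono[of "int kr" "int d"] d by (auto simp: D_def)
    have pos: "0 \<le> riesz u (q j * (q j * g j))" if "j \<in> {1..m}" for j
    proof (rule riesz_localizing_nonneg)
      show "psd_on (exps_upto (int d - int (half_deg (g j)))) (localizing_matrix (g j) u)"
        using fs that unfolding stokes_feasible_def by blast
      show "Poly_Mapping.keys (q j) \<subseteq> exps_upto (int d - int (half_deg (g j)))"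
        using kd[of j] that k[of j] exps_upto_mono[of "int (k j)" "int d - int (half_deg (g j))"]
        by (auto simp: S_def)
    qed
    have "Poly_Mapping.keys (q 0) \<subseteq> exps_upto (int d)"
      using kd[of 0] k[of 0] exps_upto_mono[of "int (k 0)" "int d"] by (auto simp: S_def)
    then have sq: "riesz u (q 0 * q 0) \<le> (\<integral>x. (rpoly_eval (q 0) x)\<^sup>2 \<partial>?\<mu>)"
      by (rule stokes_feasible_riesz_square_le[OF fs])
    have "riesz u r = u 0 + (- riesz u (q 0 * q 0) + (\<Sum>j=1..m. riesz u (q j * (q j * g j))))"
      by (simp add: r_def riesz_add riesz_one riesz_sum riesz_diff riesz_uminus S_def G_def)
    then have "u 0 \<le> riesz u r + riesz u (q 0 * q 0)"
      using sum_nonneg[of "{1..m}" "\<lambda>j. riesz u (q j * (q j * g j))"] pos by simp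
    also have "\<dots> \<le> (t / 2 * M + A * \<eta> / (2 * t)) +
        (measure ?\<mu> (semialg m g) + \<epsilon> / 3 + t / 2 * M + \<eta> / (2 * t))"
    proof (rule add_mono)
      have "riesz u r \<le> t / 2 * M + (\<integral>x. (rpoly_eval r x)\<^sup>2 \<partial>?\<mu>) / (2 * t)"
        unfolding M_def by (rule stokes_feasible_riesz_le[OF fs r_deg t])
      also have "\<dots> \<le> t / 2 * M + A * \<eta> / (2 * t)"
        using r_small t by (intro add_left_mono divide_right_mono) auto
      finally show "riesz u r \<le> t / 2 * M + A * \<eta> / (2 * t)" .
    qed (use sq q0 in linarith)
    also have "\<dots> = measure ?\<mu> (semialg m g) + \<epsilon> / 3 + t * M + (A * \<eta> + \<eta>) / (2 * t)"
      by (simp add: add_divide_distrib)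
    also have "(A * \<eta> + \<eta>) / (2 * t) \<le> \<epsilon> / 3"
    proof -
      have "\<eta> \<le> A * \<eta>" using A \<eta> by simp
      then have "(A * \<eta> + \<eta>) / (2 * t) \<le> (A * \<eta> + A * \<eta>) / (2 * t)"
        using t by (intro divide_right_mono) auto
      also have "\<dots> = \<epsilon> / 3" using A t by (simp add: \<eta>_def)
      finally show ?thesis .
    qed
    finally show "u 0 \<le> measure ?\<mu> (semialg m g) + \<epsilon>" using tM by simp
  qed
qed

text \<open>A real \<open>Sup\<close> is an upper bound only for a set bounded above; here the total
  mass is the bound.\<close>

lemma le_omega_upper:
  fixes g :: "nat \<Rightarrow> 'n::finite rpoly"
  assumes "stokes_feasible \<kappa> m g f d u v"
  shows "u 0 \<le> omega_upper \<kappa> m g f d"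
  unfolding omega_upper_def
proof (rule cSup_upper)
  show "bdd_above {u 0 | u v. stokes_feasible \<kappa> m g f d u v}"
    using stokes_feasible_u_0_le by (auto intro!: bdd_aboveI)
qed (use assms in blast)

section \<open>Summation over the pieces of the complement\<close>

theorem corollary3p3:
  fixes \<kappa> :: measure_kind
    and \<mu> :: "(real ^ 'n::finite) measure"
    and m s :: nat
    and g :: "nat \<Rightarrow> 'n rpoly"
    and mc :: "nat \<Rightarrow> nat"
    and gc :: "nat \<Rightarrow> nat \<Rightarrow> 'n rpoly"
    and f :: "nat \<Rightarrow> 'n rpoly"
    and \<Omega> \<Omega>c :: "(real ^ 'n) set"
  assumes mu: "\<mu> = ref_measure \<kappa>"
    and Omega: "\<Omega> = semialg m g"
    and exp_constraints: "\<kappa> = Exponential \<Longrightarrow> \<forall>i. \<exists>j\<in>{1..m}. g j = rvar i"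
    and Omega_c: "\<Omega>c = measure_support \<mu> - \<Omega>"
    and int_Omega: "interior \<Omega> \<noteq> {}"
    and int_Omega_c: "interior \<Omega>c \<noteq> {}"
    and pieces_supp: "\<And>l. l \<in> {1..s} \<Longrightarrow> semialg (mc l) (gc l) \<subseteq> measure_support \<mu>"
    and pieces_cover: "sym_diff \<Omega>c (\<Union>l\<in>{1..s}. semialg (mc l) (gc l)) \<in> null_sets \<mu>"
    and pieces_overlap: "\<And>k l. k \<in> {1..s} \<Longrightarrow> l \<in> {1..s} \<Longrightarrow> k \<noteq> l \<Longrightarrow>
          semialg (mc k) (gc k) \<inter> semialg (mc l) (gc l) \<in> null_sets \<mu>"
    and Omega_regular: "closure (interior \<Omega>) = \<Omega>"
    and pieces_regular: "\<And>l. l \<in> {1..s} \<Longrightarrow>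
          closure (interior (semialg (mc l) (gc l))) = semialg (mc l) (gc l)"
    and f_nonzero: "\<And>l. l \<in> {1..s} \<Longrightarrow> f l \<noteq> 0"
    and f_vanish: "\<And>l x. l \<in> {1..s} \<Longrightarrow> x \<in> frontier (semialg (mc l) (gc l)) \<Longrightarrow>
          rpoly_eval (f l) x = 0"
  shows "mono_on {min_order s mc gc..} (omega_lower \<kappa> s mc gc f) \<and>
    (\<forall>d\<ge>min_order s mc gc. omega_lower \<kappa> s mc gc f d \<le> measure \<mu> \<Omega>) \<and>
    omega_lower \<kappa> s mc gc f \<longlonglongrightarrow> measure \<mu> \<Omega>"
proof -
  define K where "K l = semialg (mc l) (gc l)" for l
  have [measurable]: "K l \<in> sets borel" for l by (simp add: K_def closed_semialg)
  have [measurable]: "\<Omega> \<in> sets borel" by (simp add: Omega closed_semialg)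
  \<comment> \<open>This gives the lower bound for each relaxation and also makes the sets under
    \<open>Sup\<close> nonempty.\<close>
  have ex: "\<exists>u v. stokes_feasible \<kappa> (mc l) (gc l) (f l) d u v \<and> u 0 = measure \<mu> (K l)"
    if l: "l \<in> {1..s}" for l d
    unfolding mu K_def
    using pieces_supp[OF l] f_nonzero[OF l] f_vanish[OF l]
    by (intro stokes_feasible_restricted_moments) (auto simp: mu measure_support_ref_measure)
  have lower: "measure \<mu> (K l) \<le> omega_upper \<kappa> (mc l) (gc l) (f l) d" if "l \<in> {1..s}" for l d
    using ex[OF that, of d] le_omega_upper by metis
  \<comment> \<open>Pairs feasible at a higher order are feasible at a lower one, so the set under
    \<open>Sup\<close> can only shrink.\<close>
  have antimono: "omega_upper \<kappa> (mc l) (gc l) (f l) d' \<le> omega_upper \<kappa> (mc l) (gc l) (f l) d"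
    if l: "l \<in> {1..s}" and d: "d \<le> d'" for l d d'
    unfolding omega_upper_def[of _ _ _ _ d']
  proof (rule cSup_least)
    show "{u 0 | u v. stokes_feasible \<kappa> (mc l) (gc l) (f l) d' u v} \<noteq> {}"
      using ex[OF l, of d'] by blast
  qed (use d in \<open>auto intro: le_omega_upper stokes_feasible_mono\<close>)
  have lim: "omega_upper \<kappa> (mc l) (gc l) (f l) \<longlonglongrightarrow> measure \<mu> (K l)" if l: "l \<in> {1..s}" for l
  proof (rule LIMSEQ_I)
    fix \<epsilon> :: real assume \<epsilon>: "0 < \<epsilon>"
    then have "0 < \<epsilon> / 2" by simp
    from stokes_feasible_eventually_le[OF this, of \<kappa> "mc l" "gc l"] obtain D where
      D: "\<And>d u v. D \<le> d \<Longrightarrow> stokes_feasible \<kappa> (mc l) (gc l) (f l) d u v \<Longrightarrow>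
        u 0 \<le> measure \<mu> (K l) + \<epsilon> / 2"
      unfolding mu K_def by blast
    have "omega_upper \<kappa> (mc l) (gc l) (f l) d \<le> measure \<mu> (K l) + \<epsilon> / 2" if "D \<le> d" for d
      unfolding omega_upper_def
    proof (rule cSup_least)
      show "{u 0 | u v. stokes_feasible \<kappa> (mc l) (gc l) (f l) d u v} \<noteq> {}"
        using ex[OF l, of d] by blast
    qed (use D[OF that] in auto)
    then show "\<exists>no. \<forall>n\<ge>no. norm (omega_upper \<kappa> (mc l) (gc l) (f l) n - measure \<mu> (K l)) < \<epsilon>"
      using lower[OF l] \<epsilon> by (intro exI[of _ D]) (smt (verit, best) field_sum_of_halves real_norm_def)
  qed
  have pieces: "(\<Sum>l=1..s. measure \<mu> (K l)) = measure \<mu> UNIV - measure \<mu> \<Omega>"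
  proof -
    have "AE x in \<mu>. x \<in> ref_supp \<kappa>" unfolding mu by (rule AE_ref_supp)
    moreover have "AE x in \<mu>. x \<notin> sym_diff \<Omega>c (\<Union>l\<in>{1..s}. K l)"
      using AE_not_in[OF pieces_cover] by (simp add: K_def)
    moreover have "AE x in \<mu>. \<forall>k\<in>{1..s}. \<forall>l\<in>{1..s}. k \<noteq> l \<longrightarrow> x \<notin> K k \<inter> K l"
      using AE_not_in[OF pieces_overlap]
      by (intro AE_finite_allI AE_impI finite_atLeastAtMost) (simp_all add: K_def)
    \<comment> \<open>Almost every point outside \<Omega> lies in exactly one piece, and almost
      every point of \<Omega> in none; integrating the indicators gives the measure
      identity.\<close>
    ultimately have ae: "AE x in \<mu>. (\<Sum>l=1..s. indicator (K l) x) = (1 :: real) - indicator \<Omega> x"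
    proof eventually_elim
      case (elim x)
      have cov: "x \<in> \<Omega> \<longleftrightarrow> (\<forall>l\<in>{1..s}. x \<notin> K l)"
        using elim(1,2) by (auto simp: Omega_c mu measure_support_ref_measure)
      show ?case
      proof (cases "x \<in> \<Omega>")
        case True
        then show ?thesis using cov by simp
      next
        case False
        with cov obtain k where k: "k \<in> {1..s}" "x \<in> K k" by blast
        have "(\<Sum>l=1..s. indicator (K l) x) = (\<Sum>l=1..s. if l = k then 1 else 0 :: real)"
          using elim(3) k by (intro sum.cong) (auto simp: indicator_def)
        then show ?thesis using k False by simp
      qed
    qed
    have ind: "integrable \<mu> (indicator A :: _ \<Rightarrow> real)" if "A \<in> sets borel" for A
      unfolding mu using that by (intro ref.integrable_bounded[of _ 1]) (auto simp: indicator_def)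
    have "(\<Sum>l=1..s. measure \<mu> (K l)) = (\<integral>x. (\<Sum>l=1..s. indicator (K l) x) \<partial>\<mu>)"
      using ind by (subst Bochner_Integration.integral_sum) (auto simp: mu)
    also have "\<dots> = (\<integral>x. 1 - indicator \<Omega> x \<partial>\<mu>)"
      using ae by (intro integral_cong_AE) (auto simp: mu)
    also have "\<dots> = measure \<mu> UNIV - measure \<mu> \<Omega>"
      using ind[of \<Omega>] by (subst Bochner_Integration.integral_diff) (auto simp: mu)
    finally show ?thesis .
  qed
  have "mono_on {min_order s mc gc..} (omega_lower \<kappa> s mc gc f)"
    unfolding omega_lower_def by (intro mono_onI diff_left_mono sum_mono antimono) auto
  moreover have "omega_lower \<kappa> s mc gc f d \<le> measure \<mu> \<Omega>" for d
    using sum_mono[of "{1..s}" "\<lambda>l. measure \<mu> (K l)" "\<lambda>l. omega_upper \<kappa> (mc l) (gc l) (f l) d"] lower pieces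
    by (simp add: omega_lower_def mu)
  moreover have "omega_lower \<kappa> s mc gc f \<longlonglongrightarrow> measure \<mu> UNIV - (\<Sum>l=1..s. measure \<mu> (K l))"
    unfolding omega_lower_def mu[symmetric] by (intro tendsto_intros lim)
  ultimately show ?thesis using pieces by simp
qed

end
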